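(* Consider the general Hubbard model of the context and suppose that the basis $\{\varphi^{(u)}\}_{u\in V}$ of $\mathcal H_0$ satisfies conditions B0, B1 and B2. Then: (i) In the subspace with electron number $N_{\rm e}\le N_{\rm d}$, the ground state energy of $H$ is $N_{\rm e}\varepsilon_0$, and every ground state is a linear combination of the states $\Phi_{A,\{m_k\}}$ with $A\subset V$, $|A|=N_{\rm e}$, and admissible $\{m_k\}$. (ii) In the subspace with electron number $N_{\rm e}>N_{\rm d}$, the ground state energy of $H$ is strictly larger than $N_{\rm e}\varepsilon_0$.
   Context: Let $\Lambda$ be a finite set, with fermion operators $c_{x\sigma},c^\dagger_{x\sigma}$ ($x\in\Lambda$, $\sigma\in\{\uparrow,\downarrow\}$) obeying the canonical anticommutation relations, vacuum $\Phi_0$, $n_{x\sigma}=c^\dagger_{x\sigma}c_{x\sigma}$, $\hat N_{\rm e}=\sum_x(n_{x\uparrow}+n_{x\downarrow})$. The Hubbard Hamiltonian is $H=H_{\rm hop}+H_{\rm int}$, $H_{\rm hop}=\sum_{x,y\in\Lambda}\sum_\sigma t_{xy}c^\dagger_{x\sigma}c_{y\sigma}$, $H_{\rm int}=\sum_xU_xn_{x\uparrow}n_{x\downarrow}$, with $(t_{xy})$ real symmetric and all $U_x>0$. Let $\varepsilon_0$ be the smallest eigenvalue of $(t_{xy})$, $\mathcal H_0$ its eigenspace, $N_{\rm d}=\dim\mathcal H_0$, and $\{\varphi^{(u)}\}_{u\in V}$ a basis of $\mathcal H_0$ indexed by a finite set $V$; $a^\dagger_{u\sigma}=\sum_x\varphi^{(u)}_xc^\dagger_{x\sigma}$.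 Conditions: B0: $\{\varphi^{(u)}\}_{u\in V}$ is a linearly independent complete basis of $\mathcal H_0$ (so $|V|=N_{\rm d}$) and each $\varphi^{(u)}$ is real-valued. B1 (quasi-locality): for each $u\in V$ there is a site $x(u)\in\Lambda$ with $\varphi^{(u)}_{x(u)}\ne0$ and $\varphi^{(v)}_{x(u)}=0$ for all $v\ne u$. B2 (local connectivity): for each $x\in\Lambda$ there are at most two indices $u\in V$ with $\varphi^{(u)}_x\ne0$. States $\Phi_{A,\{m_k\}}$: two indices $u,v\in V$ are directly connected if $\varphi^{(u)}_x\varphi^{(v)}_x\neq0$ for some $x$; for $A\subset V$ with connected components $C_1,\dots,C_n$ (w.r.t. direct connection), let $\Lambda_k=\{x:\varphi^{(u)}_x\ne0\text{ for some }u\in C_k\}$, $\hat S^-_k=\sum_{x\in\Lambda_k}c^\dagger_{x\downarrow}c_{x\uparrow}$, and for $m_k\in\{-|C_k|/2,1-|C_k|/2,\dots,|C_k|/2\}$ set $\Phi_{A,\{m_k\}}=\{\prod_{k=1}^n(\hat S^-_k)^{|C_k|/2-m_k}\}\prod_{u\in A}a^\dagger_{u\uparrow}\Phi_0$. *)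

theory Defs
  imports Complex_Main
begin

datatype spin = Up | Dn

lemma UNIV_spin: "(UNIV :: spin set) = {Up, Dn}"
  using spin.exhaust by auto

instance spin :: finite
  by standard (simp add: UNIV_spin)

text \<open>A state of the Fock space is a complex function on occupation configurations,
  i.e. on sets of occupied modes (site, spin).  The basis vector of a configuration S is
  the state with the modes of S created in the fixed mode order below (site order, then
  Up before Dn).\<close>

type_synonym 'x fock = "('x \<times> spin) set \<Rightarrow> complex"

definition mode_less :: "('x::linorder \<times> spin) \<Rightarrow> ('x \<times> spin) \<Rightarrow> bool" where
  "mode_less m m' \<longleftrightarrow> fst m < fst m' \<or> (fst m = fst m' \<and> snd m = Up \<and> snd m' = Dn)"

definition fsign :: "('x::linorder \<times> spin) set \<Rightarrow> ('x \<times> spin) \<Rightarrow> complex" where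
  "fsign S m = (-1) ^ card {m' \<in> S. mode_less m' m}"

definition cdag :: "('x::{finite,linorder} \<times> spin) \<Rightarrow> 'x fock \<Rightarrow> 'x fock" where
  "cdag m \<psi> = (\<lambda>S. if m \<in> S then fsign (S - {m}) m * \<psi> (S - {m}) else 0)"

definition cann :: "('x::{finite,linorder} \<times> spin) \<Rightarrow> 'x fock \<Rightarrow> 'x fock" where
  "cann m \<psi> = (\<lambda>S. if m \<notin> S then fsign S m * \<psi> (insert m S) else 0)"

definition vac :: "'x fock" where
  "vac = (\<lambda>S. if S = {} then 1 else 0)"

definition num_op :: "('x::{finite,linorder} \<times> spin) \<Rightarrow> 'x fock \<Rightarrow> 'x fock" where
  "num_op m \<psi> = cdag m (cann m \<psi>)"

definition Ne_op :: "'x::{finite,linorder} fock \<Rightarrow> 'x fock" where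
  "Ne_op \<psi> = (\<lambda>S. \<Sum>x\<in>UNIV. \<Sum>\<sigma>\<in>UNIV. num_op (x,\<sigma>) \<psi> S)"

definition H_hop :: "('x::{finite,linorder} \<Rightarrow> 'x \<Rightarrow> real) \<Rightarrow> 'x fock \<Rightarrow> 'x fock" where
  "H_hop t \<psi> = (\<lambda>S. \<Sum>x\<in>UNIV. \<Sum>y\<in>UNIV. \<Sum>\<sigma>\<in>UNIV.
      of_real (t x y) * cdag (x,\<sigma>) (cann (y,\<sigma>) \<psi>) S)"

definition H_int :: "('x::{finite,linorder} \<Rightarrow> real) \<Rightarrow> 'x fock \<Rightarrow> 'x fock" where
  "H_int U \<psi> = (\<lambda>S. \<Sum>x\<in>UNIV. of_real (U x) * num_op (x,Up) (num_op (x,Dn) \<psi>) S)"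

definition hubbard :: "('x::{finite,linorder} \<Rightarrow> 'x \<Rightarrow> real) \<Rightarrow> ('x \<Rightarrow> real) \<Rightarrow> 'x fock \<Rightarrow> 'x fock" where
  "hubbard t U \<psi> = (\<lambda>S. H_hop t \<psi> S + H_int U \<psi> S)"

definition sector :: "nat \<Rightarrow> 'x::{finite,linorder} fock set" where
  "sector N = {\<psi>. Ne_op \<psi> = (\<lambda>S. of_nat N * \<psi> S)}"

text \<open>Eigenvalues of H in the N-electron subspace (H is Hermitian, so they are real).\<close>
definition sector_eigvals :: "('x::{finite,linorder} fock \<Rightarrow> 'x fock) \<Rightarrow> nat \<Rightarrow> real set" where
  "sector_eigvals H N = {E. \<exists>\<psi>\<in>sector N. \<psi> \<noteq> (\<lambda>_. 0) \<and> H \<psi> = (\<lambda>S. of_real E * \<psi> S)}"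

definition ground_energy :: "('x::{finite,linorder} fock \<Rightarrow> 'x fock) \<Rightarrow> nat \<Rightarrow> real" where
  "ground_energy H N = Min (sector_eigvals H N)"

definition ground_states :: "('x::{finite,linorder} fock \<Rightarrow> 'x fock) \<Rightarrow> nat \<Rightarrow> 'x fock set" where
  "ground_states H N = {\<psi>\<in>sector N. H \<psi> = (\<lambda>S. of_real (ground_energy H N) * \<psi> S)}"

definition in_cspan :: "'x fock set \<Rightarrow> 'x fock \<Rightarrow> bool" where
  "in_cspan G \<psi> \<longleftrightarrow> (\<exists>F c. finite F \<and> F \<subseteq> G \<and> \<psi> = (\<lambda>S. \<Sum>g\<in>F. c g * g S))"

definition mat_eigvals :: "('x::finite \<Rightarrow> 'x \<Rightarrow> real) \<Rightarrow> real set" where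
  "mat_eigvals t = {ev. \<exists>v::'x \<Rightarrow> complex. v \<noteq> (\<lambda>_. 0) \<and>
      (\<forall>x. (\<Sum>y\<in>UNIV. of_real (t x y) * v y) = of_real ev * v x)}"

definition eps0 :: "('x::finite \<Rightarrow> 'x \<Rightarrow> real) \<Rightarrow> real" where
  "eps0 t = Min (mat_eigvals t)"

definition H0 :: "('x::finite \<Rightarrow> 'x \<Rightarrow> real) \<Rightarrow> ('x \<Rightarrow> complex) set" where
  "H0 t = {v. \<forall>x. (\<Sum>y\<in>UNIV. of_real (t x y) * v y) = of_real (eps0 t) * v x}"

definition B0 :: "('x::finite \<Rightarrow> 'x \<Rightarrow> real) \<Rightarrow> ('v::finite \<Rightarrow> 'x \<Rightarrow> complex) \<Rightarrow> bool" where
  "B0 t \<phi> \<longleftrightarrow> (\<forall>u. \<phi> u \<in> H0 t)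
     \<and> (\<forall>c::'v \<Rightarrow> complex. (\<forall>x. (\<Sum>u\<in>UNIV. c u * \<phi> u x) = 0) \<longrightarrow> (\<forall>u. c u = 0))
     \<and> (\<forall>v\<in>H0 t. \<exists>c. \<forall>x. v x = (\<Sum>u\<in>UNIV. c u * \<phi> u x))
     \<and> (\<forall>u x. \<phi> u x \<in> \<real>)"

definition B1 :: "('v \<Rightarrow> 'x \<Rightarrow> complex) \<Rightarrow> bool" where
  "B1 \<phi> \<longleftrightarrow> (\<forall>u. \<exists>x. \<phi> u x \<noteq> 0 \<and> (\<forall>v. v \<noteq> u \<longrightarrow> \<phi> v x = 0))"

definition B2 :: "('v \<Rightarrow> 'x \<Rightarrow> complex) \<Rightarrow> bool" where
  "B2 \<phi> \<longleftrightarrow> (\<forall>x. card {u. \<phi> u x \<noteq> 0} \<le> 2)"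

definition adag :: "('v \<Rightarrow> 'x::{finite,linorder} \<Rightarrow> complex) \<Rightarrow> 'v \<Rightarrow> spin \<Rightarrow> 'x fock \<Rightarrow> 'x fock" where
  "adag \<phi> u \<sigma> \<psi> = (\<lambda>S. \<Sum>x\<in>UNIV. \<phi> u x * cdag (x,\<sigma>) \<psi> S)"

definition dconn :: "('v \<Rightarrow> 'x \<Rightarrow> complex) \<Rightarrow> 'v \<Rightarrow> 'v \<Rightarrow> bool" where
  "dconn \<phi> u v \<longleftrightarrow> (\<exists>x. \<phi> u x * \<phi> v x \<noteq> 0)"

definition comp_of :: "('v \<Rightarrow> 'x \<Rightarrow> complex) \<Rightarrow> 'v set \<Rightarrow> 'v \<Rightarrow> 'v set" where
  "comp_of \<phi> A u = {v. (u, v) \<in> {(a, b). a \<in> A \<and> b \<in> A \<and> dconn \<phi> a b}\<^sup>*}"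

definition comps :: "('v \<Rightarrow> 'x \<Rightarrow> complex) \<Rightarrow> 'v set \<Rightarrow> 'v set set" where
  "comps \<phi> A = comp_of \<phi> A ` A"

definition support_sites :: "('v \<Rightarrow> 'x \<Rightarrow> complex) \<Rightarrow> 'v set \<Rightarrow> 'x set" where
  "support_sites \<phi> C = {x. \<exists>u\<in>C. \<phi> u x \<noteq> 0}"

definition Sminus :: "('v \<Rightarrow> 'x::{finite,linorder} \<Rightarrow> complex) \<Rightarrow> 'v set \<Rightarrow> 'x fock \<Rightarrow> 'x fock" where
  "Sminus \<phi> C \<psi> = (\<lambda>S. \<Sum>x\<in>support_sites \<phi> C. cdag (x,Dn) (cann (x,Up) \<psi>) S)"

definition admissible :: "('v \<Rightarrow> 'x \<Rightarrow> complex) \<Rightarrow> 'v set \<Rightarrow> ('v set \<Rightarrow> real) \<Rightarrow> bool" where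
  "admissible \<phi> A m \<longleftrightarrow>
     (\<forall>C\<in>comps \<phi> A. m C \<in> {real (card C) / 2 - real j | j. j \<le> card C})"

text \<open>prod_{u in A} a^dag_{u Up} Phi_0 (product taken in increasing order of u; the order
  only affects the overall sign).\<close>
definition up_state :: "('v::linorder \<Rightarrow> 'x::{finite,linorder} \<Rightarrow> complex) \<Rightarrow> 'v set \<Rightarrow> 'x fock" where
  "up_state \<phi> A = foldr (\<lambda>u \<psi>. adag \<phi> u Up \<psi>) (sorted_list_of_set A) vac"

text \<open>Apply (S^-_k)^(|C_k|/2 - m_k) for every component C_k (each component enumerated once,
  via its least element; these operators commute).\<close>
definition Phi :: "('v::{finite,linorder} \<Rightarrow> 'x::{finite,linorder} \<Rightarrow> complex) \<Rightarrow> 'v set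
    \<Rightarrow> ('v set \<Rightarrow> real) \<Rightarrow> 'x fock" where
  "Phi \<phi> A m = foldr
     (\<lambda>u \<psi>. (Sminus \<phi> (comp_of \<phi> A u) ^^
               nat \<lfloor>real (card (comp_of \<phi> A u)) / 2 - m (comp_of \<phi> A u)\<rfloor>) \<psi>)
     (filter (\<lambda>u. u = Min (comp_of \<phi> A u)) (sorted_list_of_set A))
     (up_state \<phi> A)"

end

theory Submission
  imports Defs "HOL-Analysis.Analysis"
begin

text \<open>The energy of an \<open>N\<close>-electron state \<open>\<psi>\<close> above \<open>N \<epsilon>\<^sub>0\<close> is a sum of non-negative terms, so
  it vanishes exactly if \<open>\<psi>\<close> has no doubly occupied site and all vectors \<open>x \<mapsto> (c\<^bsub>x\<sigma>\<^esub> \<psi>)(S)\<close> lie in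
  the lowest eigenspace. By B1 such a state is determined by its amplitudes on configurations
  supported on the special sites \<open>x(u)\<close>, of which there are \<open>N\<^sub>d\<close>; for \<open>N > N\<^sub>d\<close> these amplitudes vanish
  for lack of single-occupancy configurations. For \<open>N \<le> N\<^sub>d\<close>, B2 makes the amplitudes invariant under
  exchange of the spins of directly connected indices, so they depend only on the set \<open>A\<close> of occupied
  indices and on the number of down spins in every component of \<open>A\<close>. The state \<open>\<Phi>\<^bsub>A,m\<^esub>\<close> is a nonzero
  constant on one such class of configurations and zero on the others, so the \<open>\<Phi>\<^bsub>A,m\<^esub>\<close> span.\<close>

section \<open>Self-adjoint operators on Euclidean spaces\<close>

text \<open>If \<open>f v\<close> were nonzero, a small step from \<open>v\<close> against
  \<open>f v\<close> would change the quadratic form by a negative first-order term that beats the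
  second-order one, making the form negative on \<open>W\<close>. This turns a vanishing expectation
  value into an eigenvector equation.\<close>

lemma selfadjoint_psd_kernel:
  fixes f :: "'a::real_inner \<Rightarrow> 'a"
  assumes lin: "linear f" and sa: "\<And>x y. f x \<bullet> y = x \<bullet> f y"
    and W: "subspace W" "f ` W \<subseteq> W" and psd: "\<And>x. x \<in> W \<Longrightarrow> f x \<bullet> x \<ge> 0"
    and v: "v \<in> W" "f v \<bullet> v = 0"
  shows "f v = 0"
proof (rule ccontr)
  assume ne: "f v \<noteq> 0"
  define w where "w = f v"
  define q where "q = f w \<bullet> w"
  have wW: "w \<in> W" using W(2) v(1) by (auto simp: w_def)
  have ww: "w \<bullet> w > 0" using ne by (simp add: w_def)
  have q0: "q \<ge> 0" using psd[OF wW] by (simp add: q_def)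
  have ex: "0 \<le> 2 * s * (w \<bullet> w) + s * s * q" for s
  proof -
    have "v + s *\<^sub>R w \<in> W" using W(1) v(1) wW by (simp add: subspace_add subspace_scale)
    then have "0 \<le> f (v + s *\<^sub>R w) \<bullet> (v + s *\<^sub>R w)" by (rule psd)
    also have "\<dots> = f v \<bullet> v + s * (f v \<bullet> w) + s * (f w \<bullet> v) + s * s * (f w \<bullet> w)"
      by (simp add: linear_add[OF lin] linear_scale[OF lin] inner_add_left inner_add_right algebra_simps)
    also have "f w \<bullet> v = w \<bullet> w" by (simp add: sa w_def)
    finally show ?thesis using v(2) by (simp add: q_def w_def algebra_simps)
  qed
  \<comment> \<open>With \<open>s = - c\<close> the right-hand side of \<open>ex\<close> becomes
    \<open>- (c * c * (q + 2))\<close>; the added 1 keeps the denominator positive when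
    \<open>q = 0\<close>.\<close>
  define c where "c = (w \<bullet> w) / (q + 1)"
  have c: "w \<bullet> w = c * (q + 1)" "c > 0" using ww q0 by (simp_all add: c_def)
  have "0 \<le> - (c * c * (q + 2))" using ex[of "- c"] by (simp add: c(1) algebra_simps)
  moreover have "0 < c * c * (q + 2)" using c(2) q0 by simp
  ultimately show False by linarith
qed

text \<open>The Rayleigh quotient attains its minimum on the compact unit sphere of
  \<open>W\<close>, and the minimizer lies in the kernel of \<open>f\<close> minus that minimum. The
  invariant subspace \<open>W\<close> allows the electron number to be fixed.\<close>

lemma selfadjoint_min_eigenvector:
  fixes f :: "'a::euclidean_space \<Rightarrow> 'a"
  assumes lin: "linear f" and sa: "\<And>x y. f x \<bullet> y = x \<bullet> f y"
    and W: "subspace W" "f ` W \<subseteq> W" and a: "a \<in> W" "a \<noteq> 0"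
  obtains l v where "v \<in> W" "v \<noteq> 0" "f v = l *\<^sub>R v"
    "\<And>w. w \<in> W \<Longrightarrow> l * (w \<bullet> w) \<le> f w \<bullet> w"
proof -
  let ?K = "sphere 0 1 \<inter> W"
  have comp: "compact ?K" using closed_subspace[OF W(1)] by (simp add: compact_Int_closed)
  have ne: "?K \<noteq> {}"
  proof -
    have "(1 / norm a) *\<^sub>R a \<in> ?K" using a W(1) by (simp add: subspace_scale)
    then show ?thesis by blast
  qed
  have cont: "continuous_on ?K (\<lambda>x. f x \<bullet> x)"
    by (intro continuous_intros linear_continuous_on_compose[OF continuous_on_id lin])
  obtain v where v: "v \<in> ?K" and min: "\<And>y. y \<in> ?K \<Longrightarrow> f v \<bullet> v \<le> f y \<bullet> y"
    using continuous_attains_inf[OF comp ne cont] by blast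
  define l where "l = f v \<bullet> v"
  have vv: "v \<bullet> v = 1" using v by (simp add: dot_square_norm)
  have le: "l * (w \<bullet> w) \<le> f w \<bullet> w" if w: "w \<in> W" for w
  proof (cases "w = 0")
    case False
    let ?y = "(1 / norm w) *\<^sub>R w"
    have "?y \<in> ?K" using w False W(1) by (simp add: subspace_scale)
    then have "l \<le> f ?y \<bullet> ?y" unfolding l_def by (rule min)
    also have "\<dots> = (f w \<bullet> w) / (w \<bullet> w)"
      by (simp add: linear_scale[OF lin] dot_square_norm power2_eq_square)
    finally show ?thesis using False by (simp add: field_simps)
  qed (simp add: linear_0[OF lin])
  define g where "g = (\<lambda>x. f x - l *\<^sub>R x)"
  have "g v = 0"
  proof (rule selfadjoint_psd_kernel[where f = g and v = v and W = W])
    show "linear g" unfolding g_def by (intro linear_compose_sub lin linear_scale_self)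
    show "g x \<bullet> y = x \<bullet> g y" for x y by (simp add: g_def inner_diff_left inner_diff_right sa)
    show "g ` W \<subseteq> W" using W by (auto simp: g_def subspace_diff subspace_scale)
    show "0 \<le> g x \<bullet> x" if "x \<in> W" for x using le[OF that] by (simp add: g_def inner_diff_left)
    show "v \<in> W" using v by simp
    show "g v \<bullet> v = 0" using vv by (simp add: g_def inner_diff_left l_def)
  qed (rule W)
  moreover have "v \<noteq> 0" using vv by auto
  ultimately show thesis using that[of v l] v le by (simp add: g_def)
qed

text \<open>Eigenvectors of distinct eigenvalues are orthogonal, hence independent, hence finite in
  number. Thus the minima in \<open>eps0\<close> and \<open>ground_energy\<close> range over finite
  sets.\<close>

lemma finite_selfadjoint_eigenvalues:
  fixes f :: "'a::euclidean_space \<Rightarrow> 'a"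
  assumes sa: "\<And>x y. f x \<bullet> y = x \<bullet> f y"
  shows "finite {l. \<exists>v. v \<noteq> 0 \<and> f v = l *\<^sub>R v}"
proof -
  let ?E = "{l. \<exists>v. v \<noteq> 0 \<and> f v = l *\<^sub>R v}"
  obtain e where e: "\<And>l. l \<in> ?E \<Longrightarrow> e l \<noteq> 0 \<and> f (e l) = l *\<^sub>R e l"
    using bchoice[of ?E "\<lambda>l v. v \<noteq> 0 \<and> f v = l *\<^sub>R v"] by blast
  have orth: "e l \<bullet> e m = 0" if "l \<in> ?E" "m \<in> ?E" "l \<noteq> m" for l m
  proof -
    have "l * (e l \<bullet> e m) = m * (e l \<bullet> e m)"
      using sa[of "e l" "e m"] e[OF that(1)] e[OF that(2)] by simp
    then show ?thesis using that(3) by simp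
  qed
  have inj: "inj_on e ?E"
  proof (rule inj_onI, rule ccontr)
    fix l m assume lm: "l \<in> ?E" "m \<in> ?E" "e l = e m" "l \<noteq> m"
    then have "e m \<bullet> e m = 0" using orth[OF lm(1,2,4)] by simp
    then show False using e[OF lm(2)] by simp
  qed
  have "pairwise orthogonal (e ` ?E)"
    by (rule pairwise_imageI) (unfold orthogonal_def, rule orth)
  moreover have "0 \<notin> e ` ?E"
  proof
    assume "0 \<in> e ` ?E"
    then obtain l where "l \<in> ?E" "e l = 0" by (elim imageE) simp
    with e show False by blast
  qed
  ultimately have "independent (e ` ?E)" by (rule pairwise_orthogonal_independent)
  then have "finite (e ` ?E)" using independent_imp_finite by blast
  then show ?thesis using inj finite_imageD by blast
qed

section \<open>Fermion operators\<close>

lemma mode_less_flip: "m \<noteq> m' \<Longrightarrow> mode_less m' m \<longleftrightarrow> \<not> mode_less m m'"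
  by (cases m; cases m'; cases "snd m"; cases "snd m'") (auto simp: mode_less_def)

lemma fsign_cases: "fsign S m = 1 \<or> fsign S m = -1"
  unfolding fsign_def by (metis neg_one_even_power neg_one_odd_power)

lemma fsign_nonzero [simp]: "fsign S m \<noteq> 0"
  by (simp add: fsign_def)

lemma fsign_square [simp]: "fsign S m * fsign S m = 1" "fsign S m * (fsign S m * z) = z"
  using fsign_cases[of S m] by auto

lemma inner_fsign: "inner a (fsign S m * b) = inner (fsign S m * a) b"
  using fsign_cases[of S m] by auto

lemma fsign_insert:
  fixes S :: "('x::{finite,linorder} \<times> spin) set"
  assumes "m \<notin> S"
  shows "fsign (insert m S) m' = (if mode_less m m' then - fsign S m' else fsign S m')"
proof (cases "mode_less m m'")
  case True
  then have "{k \<in> insert m S. mode_less k m'} = insert m {k \<in> S. mode_less k m'}" by auto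
  then show ?thesis using True assms by (simp add: fsign_def)
next
  case False
  then have "{k \<in> insert m S. mode_less k m'} = {k \<in> S. mode_less k m'}" by auto
  then show ?thesis using False by (simp add: fsign_def)
qed

text \<open>\<open>(x, Up)\<close> is the only mode that precedes \<open>(x, Dn)\<close> without
  preceding \<open>(x, Up)\<close>.\<close>

lemma fsign_Dn_eq_Up: "(x, Up) \<notin> S \<Longrightarrow> fsign S (x, Dn) = fsign S (x, Up)"
proof -
  assume "(x, Up) \<notin> S"
  then have "{k \<in> S. mode_less k (x, Dn)} = {k \<in> S. mode_less k (x, Up)}"
    by (auto simp: mode_less_def)
  then show ?thesis by (simp add: fsign_def)
qed

text \<open>Of two distinct modes exactly one precedes the other, so exactly one of the two orders
  of removal picks up the extra sign of \<open>fsign_insert\<close>.\<close>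

lemma cann_anticommute: "cann m (cann m' \<psi>) S = - cann m' (cann m \<psi>) S"
proof (cases "m = m'")
  case False
  then show ?thesis
    using mode_less_flip[of m m']
    by (auto simp: cann_def fsign_insert insert_commute)
qed (simp add: cann_def)

lemma cann_cdag: "cann m (cdag m' \<psi>) S = (if m = m' then \<psi> S else 0) - cdag m' (cann m \<psi>) S"
proof (cases "m = m'")
  case True
  then show ?thesis by (auto simp: cann_def cdag_def insert_absorb)
next
  case False
  show ?thesis
  proof (cases "m' \<in> S")
    case True
    define R where "R = S - {m'}"
    have S: "S = insert m' R" "m' \<notin> R" using True by (auto simp: R_def)
    then show ?thesis
      using False mode_less_flip[of m m'] fsign_insert[of m R m'] fsign_insert[of m' R m]
      by (auto simp: cann_def cdag_def insert_Diff_if)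
  qed (use False in \<open>auto simp: cann_def cdag_def\<close>)
qed

lemma num_op_apply: "num_op m \<psi> S = (if m \<in> S then \<psi> S else 0)"
  by (auto simp: num_op_def cdag_def cann_def insert_absorb)

lemma ex_spin: "(\<exists>\<sigma>. P \<sigma>) \<longleftrightarrow> P Up \<or> P Dn"
proof
  assume "\<exists>\<sigma>. P \<sigma>"
  then obtain \<sigma> where "P \<sigma>" ..
  then show "P Up \<or> P Dn" by (cases \<sigma>) auto
qed auto

lemma sum_modes: "(\<Sum>x\<in>UNIV. \<Sum>\<sigma>\<in>UNIV. f (x, \<sigma>)) = sum f (UNIV :: ('x::finite \<times> spin) set)"
  by (simp add: sum.cartesian_product UNIV_Times_UNIV[symmetric] del: UNIV_Times_UNIV)

lemma Ne_op_apply: "Ne_op \<psi> S = of_nat (card S) * \<psi> S"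
proof -
  have "Ne_op \<psi> S = (\<Sum>m\<in>UNIV. if m \<in> S then \<psi> S else 0)"
    unfolding Ne_op_def num_op_apply by (rule sum_modes)
  also have "\<dots> = (\<Sum>m\<in>S. \<psi> S)" by (simp add: sum.If_cases)
  finally show ?thesis by simp
qed

lemma sector_iff: "\<psi> \<in> sector N \<longleftrightarrow> (\<forall>S. \<psi> S \<noteq> 0 \<longrightarrow> card S = N)"
  unfolding sector_def by (auto simp: fun_eq_iff Ne_op_apply)

lemma sectorD: "\<psi> \<in> sector N \<Longrightarrow> card S \<noteq> N \<Longrightarrow> \<psi> S = 0"
  by (auto simp: sector_iff)

section \<open>Inner product on Fock space and adjoints\<close>

text \<open>This is the real part of the Hermitian product; with it the states form a real Euclidean
  space, to which the results on self-adjoint maps apply.\<close>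

definition fock_inner :: "'x::finite fock \<Rightarrow> 'x fock \<Rightarrow> real" where
  "fock_inner \<psi> \<xi> = (\<Sum>S\<in>UNIV. inner (\<psi> S) (\<xi> S))"

lemma fock_inner_commute: "fock_inner \<psi> \<xi> = fock_inner \<xi> \<psi>"
  by (simp add: fock_inner_def inner_commute)

text \<open>Inserting \<open>m\<close> is a bijection from the configurations without
  \<open>m\<close> to those with it, and the sign, being real, passes to the other argument.\<close>

lemma fock_inner_cdag: "fock_inner \<psi> (cdag m \<xi>) = fock_inner (cann m \<psi>) \<xi>"
proof -
  have "fock_inner \<psi> (cdag m \<xi>) = (\<Sum>S\<in>{S. m \<in> S}. inner (\<psi> S) (fsign (S - {m}) m * \<xi> (S - {m})))"
    unfolding fock_inner_def cdag_def by (simp add: if_distrib[of "inner _"] sum.If_cases)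
  also have "\<dots> = (\<Sum>S\<in>{S. m \<notin> S}. inner (fsign S m * \<psi> (insert m S)) (\<xi> S))"
    by (rule sum.reindex_bij_witness[where i = "insert m" and j = "\<lambda>S. S - {m}"])
      (auto simp: insert_absorb inner_fsign)
  also have "\<dots> = fock_inner (cann m \<psi>) \<xi>"
    unfolding fock_inner_def cann_def
    by (simp add: if_distrib[of "\<lambda>z. inner z _"] sum.If_cases)
  finally show ?thesis .
qed

lemma fock_inner_sum_right:
  "fock_inner \<psi> (\<lambda>S. \<Sum>i\<in>I. g i S) = (\<Sum>i\<in>I. fock_inner \<psi> (g i))"
  unfolding fock_inner_def inner_sum_right by (rule sum.swap)

lemma inner_of_real_mult [simp]:
  fixes z w :: complex
  shows "inner z (of_real a * w) = a * inner z w" "inner (of_real a * z) w = a * inner z w"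
  by (simp_all add: scaleR_conv_of_real[symmetric])

lemma fock_inner_scale_right: "fock_inner \<psi> (\<lambda>S. of_real a * \<xi> S) = a * fock_inner \<psi> \<xi>"
  by (simp add: fock_inner_def sum_distrib_left)

lemma fock_inner_add_right:
  "fock_inner \<psi> (\<lambda>S. \<xi> S + \<xi>' S) = fock_inner \<psi> \<xi> + fock_inner \<psi> \<xi>'"
  by (simp add: fock_inner_def inner_add_right sum.distrib)

lemma fock_inner_self_pos: "\<psi> \<noteq> (\<lambda>_. 0) \<Longrightarrow> fock_inner \<psi> \<psi> > 0"
proof -
  assume "\<psi> \<noteq> (\<lambda>_. 0)"
  then obtain S where "\<psi> S \<noteq> 0" by auto
  then show ?thesis unfolding fock_inner_def by (intro sum_pos2[of _ S]) auto
qed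

lemma cann_add: "cann m (\<lambda>S. \<psi> S + \<xi> S) = (\<lambda>S. cann m \<psi> S + cann m \<xi> S)"
  by (auto simp: cann_def algebra_simps)

lemma cann_scale: "cann m (\<lambda>S. c * \<psi> S) = (\<lambda>S. c * cann m \<psi> S)"
  by (auto simp: cann_def)

lemma cdag_add: "cdag m (\<lambda>S. \<psi> S + \<xi> S) = (\<lambda>S. cdag m \<psi> S + cdag m \<xi> S)"
  by (auto simp: cdag_def algebra_simps)

lemma cdag_scale: "cdag m (\<lambda>S. c * \<psi> S) = (\<lambda>S. c * cdag m \<psi> S)"
  by (auto simp: cdag_def)

lemma hubbard_add: "hubbard t U (\<lambda>S. \<psi> S + \<xi> S) = (\<lambda>S. hubbard t U \<psi> S + hubbard t U \<xi> S)"
  by (simp add: hubbard_def H_hop_def H_int_def num_op_def cann_add cdag_add sum.distrib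
      distrib_left add_ac fun_eq_iff)

lemma hubbard_scale: "hubbard t U (\<lambda>S. c * \<psi> S) = (\<lambda>S. c * hubbard t U \<psi> S)"
  by (simp add: hubbard_def H_hop_def H_int_def num_op_def cann_scale cdag_scale sum_distrib_left
      distrib_left mult.left_commute fun_eq_iff)

lemma fock_inner_hubbard:
  "fock_inner \<psi> (hubbard t U \<xi>) =
    (\<Sum>x\<in>UNIV. \<Sum>y\<in>UNIV. \<Sum>\<sigma>\<in>UNIV. t x y * fock_inner (cann (x,\<sigma>) \<psi>) (cann (y,\<sigma>) \<xi>)) +
    (\<Sum>x\<in>UNIV. U x * (\<Sum>S\<in>{S. (x,Up) \<in> S \<and> (x,Dn) \<in> S}. inner (\<psi> S) (\<xi> S)))"
proof -
  have int: "fock_inner \<psi> (num_op (x,Up) (num_op (x,Dn) \<xi>)) =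
      (\<Sum>S\<in>{S. (x,Up) \<in> S \<and> (x,Dn) \<in> S}. inner (\<psi> S) (\<xi> S))" for x
    unfolding fock_inner_def by (rule sum.mono_neutral_cong_right) (auto simp: num_op_apply)
  show ?thesis
    unfolding hubbard_def H_hop_def H_int_def
    by (simp add: fock_inner_add_right fock_inner_sum_right fock_inner_scale_right
        fock_inner_cdag int)
qed

lemma hubbard_selfadjoint:
  assumes "\<forall>x y. t x y = t y x"
  shows "fock_inner \<psi> (hubbard t U \<xi>) = fock_inner (hubbard t U \<psi>) \<xi>"
proof -
  have "(\<Sum>x\<in>UNIV. \<Sum>y\<in>UNIV. \<Sum>\<sigma>\<in>UNIV. t x y * fock_inner (cann (x,\<sigma>) \<psi>) (cann (y,\<sigma>) \<xi>)) =
    (\<Sum>x\<in>UNIV. \<Sum>y\<in>UNIV. \<Sum>\<sigma>\<in>UNIV. t x y * fock_inner (cann (x,\<sigma>) \<xi>) (cann (y,\<sigma>) \<psi>))"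
    using assms by (subst sum.swap) (simp add: fock_inner_commute)
  then show ?thesis
    by (simp only: fock_inner_hubbard fock_inner_commute[of "hubbard t U \<psi>"] inner_commute)
qed

lemma hubbard_sector:
  assumes "\<psi> \<in> sector N"
  shows "hubbard t U \<psi> \<in> sector N"
proof -
  have "cdag m (cann m' \<psi>) S = 0" if "card S \<noteq> N" for m m' S
  proof (cases "m \<in> S \<and> m' \<notin> S - {m}")
    case True
    then have "card (insert m' (S - {m})) = card S" using card_Suc_Diff1[of S m] by simp
    then show ?thesis using assms that by (auto simp: cdag_def cann_def intro: sectorD)
  qed (auto simp: cdag_def cann_def)
  moreover have "num_op m (num_op m' \<psi>) S = 0" if "card S \<noteq> N" for m m' S
    using sectorD[OF assms that] by (simp add: num_op_apply[of m] num_op_apply[of m'])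
  ultimately have "hubbard t U \<psi> S = 0" if "card S \<noteq> N" for S
    using that by (simp add: hubbard_def H_hop_def H_int_def)
  then show ?thesis by (auto simp: sector_iff)
qed

text \<open>Writing the electron number through the norms of the states
  \<open>cann (x,\<sigma>) \<psi>\<close> allows \<open>real N * eps0 t\<close> to be subtracted
  from the hopping energy term by term.\<close>

lemma fock_inner_number:
  assumes "\<psi> \<in> sector N"
  shows "real N * fock_inner \<psi> \<psi> =
    (\<Sum>x\<in>UNIV. \<Sum>\<sigma>\<in>UNIV. fock_inner (cann (x,\<sigma>) \<psi>) (cann (x,\<sigma>) \<psi>))"
proof -
  have "real N * fock_inner \<psi> \<psi> = fock_inner \<psi> (\<lambda>S. of_real (real N) * \<psi> S)"
    by (rule fock_inner_scale_right[symmetric])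
  also have "(\<lambda>S. of_real (real N) * \<psi> S) = Ne_op \<psi>" using assms by (simp add: sector_def)
  also have "fock_inner \<psi> (Ne_op \<psi>) =
      (\<Sum>x\<in>UNIV. \<Sum>\<sigma>\<in>UNIV. fock_inner (cann (x,\<sigma>) \<psi>) (cann (x,\<sigma>) \<psi>))"
    by (simp add: Ne_op_def fock_inner_sum_right num_op_def fock_inner_cdag)
  finally show ?thesis .
qed

section \<open>Spectra of the hopping matrix and of the Hamiltonian\<close>

text \<open>The type \<open>complex ^ 'x\<close> is a real Euclidean space, on which a real
  symmetric matrix is self-adjoint.\<close>

definition mat_vec :: "('x::finite \<Rightarrow> 'x \<Rightarrow> real) \<Rightarrow> complex ^ 'x \<Rightarrow> complex ^ 'x" where
  "mat_vec t v = (\<chi> x. \<Sum>y\<in>UNIV. of_real (t x y) * v $ y)"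

lemma linear_mat_vec: "linear (mat_vec t)"
  by (rule linearI)
    (simp_all add: mat_vec_def vec_eq_iff distrib_left sum.distrib sum_distrib_left
      scaleR_conv_of_real[where 'a = complex] mult.left_commute)

lemma inner_mat_vec:
  "mat_vec t v \<bullet> w = (\<Sum>x\<in>UNIV. \<Sum>y\<in>UNIV. t x y * (v $ y \<bullet> w $ x))"
  by (simp add: mat_vec_def inner_vec_def inner_sum_left)

lemma mat_vec_selfadjoint:
  assumes "\<forall>x y. t x y = t y x"
  shows "mat_vec t v \<bullet> w = v \<bullet> mat_vec t w"
  unfolding inner_mat_vec inner_commute[of v] using assms
  by (subst sum.swap) (simp add: inner_commute)

lemma mat_eigvals_eq:
  fixes t :: "'x::finite \<Rightarrow> 'x \<Rightarrow> real"
  shows "mat_eigvals t = {l. \<exists>v. v \<noteq> 0 \<and> mat_vec t v = l *\<^sub>R v}"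
proof -
  have "(\<exists>v :: 'x \<Rightarrow> complex. v \<noteq> (\<lambda>_. 0) \<and> (\<forall>x. (\<Sum>y\<in>UNIV. of_real (t x y) * v y) = of_real l * v x)) \<longleftrightarrow>
      (\<exists>v. v \<noteq> 0 \<and> mat_vec t v = l *\<^sub>R v)" for l
  proof (intro iffI; elim exE conjE)
    fix v :: "'x \<Rightarrow> complex"
    assume "v \<noteq> (\<lambda>_. 0)" "\<forall>x. (\<Sum>y\<in>UNIV. of_real (t x y) * v y) = of_real l * v x"
    then show "\<exists>v. v \<noteq> 0 \<and> mat_vec t v = l *\<^sub>R v"
      by (intro exI[of _ "vec_lambda v"])
        (auto simp: vec_eq_iff mat_vec_def scaleR_conv_of_real[where 'a = complex] fun_eq_iff)
  next
    fix v :: "complex ^ 'x"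
    assume "v \<noteq> 0" "mat_vec t v = l *\<^sub>R v"
    then show "\<exists>v :: 'x \<Rightarrow> complex. v \<noteq> (\<lambda>_. 0) \<and> (\<forall>x. (\<Sum>y\<in>UNIV. of_real (t x y) * v y) = of_real l * v x)"
      by (intro exI[of _ "vec_nth v"])
        (auto simp: vec_eq_iff mat_vec_def scaleR_conv_of_real[where 'a = complex] fun_eq_iff)
  qed
  then show ?thesis unfolding mat_eigvals_def by simp
qed

text \<open>The minimum of the Rayleigh quotient is itself an eigenvalue, hence at least the
  smallest one.\<close>

lemma eps0_le_rayleigh:
  assumes sym: "\<forall>x y. t x y = t y x"
  shows "eps0 t * (v \<bullet> v) \<le> mat_vec t v \<bullet> v"
proof (cases "v = 0")
  case False
  obtain l w where w: "w \<noteq> 0" "mat_vec t w = l *\<^sub>R w"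
    and le: "\<And>w. l * (w \<bullet> w) \<le> mat_vec t w \<bullet> w"
    by (rule selfadjoint_min_eigenvector[OF linear_mat_vec mat_vec_selfadjoint[OF sym]
          subspace_UNIV _ _ False]) auto
  have "finite (mat_eigvals t)"
    unfolding mat_eigvals_eq
    by (rule finite_selfadjoint_eigenvalues) (rule mat_vec_selfadjoint[OF sym])
  moreover have "l \<in> mat_eigvals t" using w unfolding mat_eigvals_eq by blast
  ultimately have "eps0 t \<le> l" unfolding eps0_def by (rule Min_le)
  then have "eps0 t * (v \<bullet> v) \<le> l * (v \<bullet> v)" by (intro mult_right_mono) auto
  then show ?thesis using le[of v] by linarith
qed (simp add: linear_0[OF linear_mat_vec])

text \<open>The matrix minus \<open>eps0 t\<close> is positive semidefinite, so a zero of its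
  quadratic form lies in its kernel.\<close>

lemma eps0_rayleigh_eq:
  assumes sym: "\<forall>x y. t x y = t y x" and eq: "mat_vec t v \<bullet> v = eps0 t * (v \<bullet> v)"
  shows "vec_nth v \<in> H0 t"
proof -
  define g where "g = (\<lambda>v. mat_vec t v - eps0 t *\<^sub>R v)"
  have "g v = 0"
  proof (rule selfadjoint_psd_kernel[where f = g and v = v and W = UNIV])
    show "linear g" unfolding g_def by (intro linear_compose_sub linear_mat_vec linear_scale_self)
    show "g x \<bullet> y = x \<bullet> g y" for x y
      by (simp add: g_def inner_diff_left inner_diff_right mat_vec_selfadjoint[OF sym])
    show "0 \<le> g x \<bullet> x" for x using eps0_le_rayleigh[OF sym, of x] by (simp add: g_def inner_diff_left)
    show "g v \<bullet> v = 0" using eq by (simp add: g_def inner_diff_left)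
  qed auto
  then show ?thesis
    by (auto simp: g_def H0_def mat_vec_def vec_eq_iff scaleR_conv_of_real[where 'a = complex])
qed

section \<open>States of minimal energy\<close>

definition no_double :: "'x fock \<Rightarrow> bool" where
  "no_double \<psi> \<longleftrightarrow> (\<forall>S x. (x,Up) \<in> S \<longrightarrow> (x,Dn) \<in> S \<longrightarrow> \<psi> S = 0)"

lemma no_doubleD: "no_double \<psi> \<Longrightarrow> (x,Up) \<in> S \<Longrightarrow> (x,Dn) \<in> S \<Longrightarrow> \<psi> S = 0"
  unfolding no_double_def by blast

text \<open>The kinetic energy is a sum, over spins and configurations, of the quadratic form of
  \<open>t\<close> at the vectors \<open>x \<mapsto> (c\<^bsub>x\<sigma>\<^esub> \<psi>)(S)\<close>.\<close>

lemma energy_decomposition: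
  assumes "\<psi> \<in> sector N"
  shows "fock_inner \<psi> (hubbard t U \<psi>) - real N * eps0 t * fock_inner \<psi> \<psi> =
    (\<Sum>\<sigma>\<in>UNIV. \<Sum>S\<in>UNIV. let v = (\<chi> x. cann (x,\<sigma>) \<psi> S) in mat_vec t v \<bullet> v - eps0 t * (v \<bullet> v)) +
    (\<Sum>x\<in>UNIV. \<Sum>S\<in>{S. (x,Up) \<in> S \<and> (x,Dn) \<in> S}. U x * (\<psi> S \<bullet> \<psi> S))"
proof -
  have hop: "(\<Sum>x\<in>UNIV. \<Sum>y\<in>UNIV. \<Sum>\<sigma>\<in>UNIV. t x y * fock_inner (cann (x,\<sigma>) \<psi>) (cann (y,\<sigma>) \<psi>))
      = (\<Sum>\<sigma>\<in>UNIV. \<Sum>S\<in>UNIV. mat_vec t (\<chi> x. cann (x,\<sigma>) \<psi> S) \<bullet> (\<chi> x. cann (x,\<sigma>) \<psi> S))"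
  proof -
    have "(\<Sum>x\<in>UNIV. \<Sum>y\<in>UNIV. \<Sum>\<sigma>\<in>UNIV. t x y * fock_inner (cann (x,\<sigma>) \<psi>) (cann (y,\<sigma>) \<psi>))
      = (\<Sum>x\<in>UNIV. \<Sum>\<sigma>\<in>UNIV. \<Sum>y\<in>UNIV. \<Sum>S\<in>UNIV. t x y * (cann (y,\<sigma>) \<psi> S \<bullet> cann (x,\<sigma>) \<psi> S))"
      by (subst (2) sum.swap) (simp add: fock_inner_def sum_distrib_left inner_commute)
    also have "\<dots> = (\<Sum>\<sigma>\<in>UNIV. \<Sum>x\<in>UNIV. \<Sum>y\<in>UNIV. \<Sum>S\<in>UNIV. t x y * (cann (y,\<sigma>) \<psi> S \<bullet> cann (x,\<sigma>) \<psi> S))"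
      by (rule sum.swap)
    also have "\<dots> = (\<Sum>\<sigma>\<in>UNIV. \<Sum>S\<in>UNIV. \<Sum>x\<in>UNIV. \<Sum>y\<in>UNIV. t x y * (cann (y,\<sigma>) \<psi> S \<bullet> cann (x,\<sigma>) \<psi> S))"
    proof (rule sum.cong[OF refl])
      fix \<sigma>
      let ?f = "\<lambda>x y S. t x y * (cann (y,\<sigma>) \<psi> S \<bullet> cann (x,\<sigma>) \<psi> S)"
      have "(\<Sum>x\<in>UNIV. \<Sum>y\<in>UNIV. \<Sum>S\<in>UNIV. ?f x y S) = (\<Sum>x\<in>UNIV. \<Sum>S\<in>UNIV. \<Sum>y\<in>UNIV. ?f x y S)"
        by (intro sum.cong refl sum.swap)
      also have "\<dots> = (\<Sum>S\<in>UNIV. \<Sum>x\<in>UNIV. \<Sum>y\<in>UNIV. ?f x y S)" by (rule sum.swap)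
      finally show "(\<Sum>x\<in>UNIV. \<Sum>y\<in>UNIV. \<Sum>S\<in>UNIV. ?f x y S) = (\<Sum>S\<in>UNIV. \<Sum>x\<in>UNIV. \<Sum>y\<in>UNIV. ?f x y S)" .
    qed
    finally show ?thesis by (simp add: inner_mat_vec)
  qed
  have num: "real N * fock_inner \<psi> \<psi>
      = (\<Sum>\<sigma>\<in>UNIV. \<Sum>S\<in>UNIV. (\<chi> x. cann (x,\<sigma>) \<psi> S) \<bullet> (\<chi> x. cann (x,\<sigma>) \<psi> S))"
    unfolding fock_inner_number[OF assms]
    by (subst sum.swap) (simp add: fock_inner_def inner_vec_def sum.swap[of _ _ "UNIV :: 'a set"])
  show ?thesis
    unfolding fock_inner_hubbard hop Let_def sum_subtractf
    by (simp add: sum_distrib_left[symmetric] num[symmetric])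
qed

lemma energy_terms_nonneg:
  assumes sym: "\<forall>x y. t x y = t y x" and pos: "\<forall>x. U x > 0"
  shows "0 \<le> (let v = (\<chi> x. cann (x,\<sigma>) \<psi> S) in mat_vec t v \<bullet> v - eps0 t * (v \<bullet> v))"
    and "0 \<le> U x * (\<psi> S \<bullet> \<psi> S)"
  using eps0_le_rayleigh[OF sym] pos by (auto simp: Let_def less_imp_le)

lemma energy_lower_bound:
  assumes "\<forall>x y. t x y = t y x" "\<forall>x. U x > 0" "\<psi> \<in> sector N"
  shows "real N * eps0 t * fock_inner \<psi> \<psi> \<le> fock_inner \<psi> (hubbard t U \<psi>)"
proof -
  have "0 \<le> fock_inner \<psi> (hubbard t U \<psi>) - real N * eps0 t * fock_inner \<psi> \<psi>"
    unfolding energy_decomposition[OF assms(3)]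
    by (intro add_nonneg_nonneg sum_nonneg energy_terms_nonneg[OF assms(1,2)])
  then show ?thesis by simp
qed

text \<open>Both sums of \<open>energy_decomposition\<close> are nonnegative and add up to zero, so
  every single term vanishes. The interaction terms then exclude double occupancy because
  \<open>U x > 0\<close>, and the hopping terms give equality in the Rayleigh bound.\<close>

lemma minimal_energy_imp:
  assumes sym: "\<forall>x y. t x y = t y x" and pos: "\<forall>x. U x > 0" and sec: "\<psi> \<in> sector N"
    and eq: "fock_inner \<psi> (hubbard t U \<psi>) = real N * eps0 t * fock_inner \<psi> \<psi>"
  shows "no_double \<psi>" and "(\<lambda>x. cann (x,\<sigma>) \<psi> S) \<in> H0 t"
proof -
  let ?q = "\<lambda>\<sigma> S. let v = (\<chi> x. cann (x,\<sigma>) \<psi> S) in mat_vec t v \<bullet> v - eps0 t * (v \<bullet> v)"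
  let ?D = "\<lambda>x. {S. (x,Up) \<in> S \<and> (x,Dn) \<in> S}"
  let ?Q = "\<Sum>\<sigma>\<in>UNIV. \<Sum>S\<in>UNIV. ?q \<sigma> S"
  let ?I = "\<Sum>x\<in>UNIV. \<Sum>S\<in>?D x. U x * (\<psi> S \<bullet> \<psi> S)"
  have q: "0 \<le> ?q \<sigma> S" for \<sigma> S by (rule energy_terms_nonneg[OF sym pos])
  have i: "0 \<le> U x * (\<psi> S \<bullet> \<psi> S)" for x S by (rule energy_terms_nonneg[OF sym pos])
  have Q: "0 \<le> ?Q" by (intro sum_nonneg q)
  have I: "0 \<le> ?I" by (intro sum_nonneg i)
  have "?Q + ?I = 0" using energy_decomposition[OF sec, of t U] eq by simp
  then have Q0: "?Q = 0" and I0: "?I = 0" using Q I by linarith+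
  have "(\<Sum>S\<in>?D x. U x * (\<psi> S \<bullet> \<psi> S)) = 0" for x
    using I0 by (subst (asm) sum_nonneg_eq_0_iff) (auto intro: sum_nonneg i)
  then have "U x * (\<psi> S \<bullet> \<psi> S) = 0" if "S \<in> ?D x" for x S
    using that sum_nonneg_eq_0_iff[OF finite, of "?D x" "\<lambda>S. U x * (\<psi> S \<bullet> \<psi> S)", OF i] by blast
  then show "no_double \<psi>" unfolding no_double_def using pos by (metis (mono_tags, lifting)
    inner_eq_zero_iff less_irrefl mem_Collect_eq mult_eq_0_iff)
  have "(\<Sum>S\<in>UNIV. ?q \<sigma> S) = 0"
    using Q0 by (subst (asm) sum_nonneg_eq_0_iff) (auto intro!: sum_nonneg q)
  then have "?q \<sigma> S = 0"
    by (subst (asm) sum_nonneg_eq_0_iff) (auto intro!: q)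
  then have "vec_nth (\<chi> x. cann (x,\<sigma>) \<psi> S) \<in> H0 t"
    by (intro eps0_rayleigh_eq[OF sym]) (simp add: Let_def)
  then show "(\<lambda>x. cann (x,\<sigma>) \<psi> S) \<in> H0 t" by (simp add: vec_lambda_inverse)
qed

text \<open>Converse of \<open>minimal_energy_imp\<close>: the interaction annihilates
  \<open>\<psi>\<close>, and the hopping acts on it as \<open>eps0 t\<close> times the number
  operator.\<close>

lemma minimal_energy_eigenstate:
  assumes sec: "\<psi> \<in> sector N" and nd: "no_double \<psi>"
    and H0: "\<And>\<sigma> S. (\<lambda>x. cann (x,\<sigma>) \<psi> S) \<in> H0 t"
  shows "hubbard t U \<psi> = (\<lambda>S. of_real (real N * eps0 t) * \<psi> S)"
proof
  fix S
  have "num_op (x,Up) (num_op (x,Dn) \<psi>) S = 0" for x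
    using nd by (simp add: num_op_apply[of "(x,Up)"] num_op_apply[of "(x,Dn)"] no_double_def)
  then have int: "H_int U \<psi> S = 0" by (simp add: H_int_def)
  have row: "(\<Sum>y\<in>UNIV. of_real (t x y) * cdag (x,\<sigma>) (cann (y,\<sigma>) \<psi>) S) =
      of_real (eps0 t) * num_op (x,\<sigma>) \<psi> S" for x \<sigma>
  proof -
    have "(\<Sum>y\<in>UNIV. of_real (t x y) * cann (y,\<sigma>) \<psi> R) = of_real (eps0 t) * cann (x,\<sigma>) \<psi> R" for R
      using H0[of \<sigma> R] by (simp add: H0_def)
    then show ?thesis
      by (simp add: num_op_def cdag_def mult.left_commute[of _ "fsign _ _"] sum_distrib_left[symmetric])
  qed
  have "H_hop t \<psi> S = (\<Sum>x\<in>UNIV. \<Sum>\<sigma>\<in>UNIV. \<Sum>y\<in>UNIV. of_real (t x y) * cdag (x,\<sigma>) (cann (y,\<sigma>) \<psi>) S)"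
    unfolding H_hop_def by (intro sum.cong refl sum.swap)
  also have "\<dots> = of_real (eps0 t) * Ne_op \<psi> S"
    by (simp add: row Ne_op_def sum_distrib_left)
  also have "Ne_op \<psi> S = of_nat N * \<psi> S" using sec by (simp add: sector_def)
  finally show "hubbard t U \<psi> S = of_real (real N * eps0 t) * \<psi> S"
    by (simp add: hubbard_def int mult_ac)
qed

section \<open>Eigenvalues at fixed electron number\<close>

definition hubbard_vec ::
    "('x::{finite,linorder} \<Rightarrow> 'x \<Rightarrow> real) \<Rightarrow> ('x \<Rightarrow> real) \<Rightarrow>
      complex ^ (('x \<times> spin) set) \<Rightarrow> complex ^ (('x \<times> spin) set)" where
  "hubbard_vec t U v = (\<chi> S. hubbard t U (vec_nth v) S)"

lemma linear_hubbard_vec: "linear (hubbard_vec t U)"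
proof (rule linearI)
  fix v w :: "complex ^ (('a \<times> spin) set)" and r :: real
  have "vec_nth (v + w) = (\<lambda>S. v $ S + w $ S)" by (simp add: fun_eq_iff)
  then show "hubbard_vec t U (v + w) = hubbard_vec t U v + hubbard_vec t U w"
    by (simp add: hubbard_vec_def vec_eq_iff hubbard_add)
  have "vec_nth (r *\<^sub>R v) = (\<lambda>S. of_real r * v $ S)"
    by (simp add: fun_eq_iff scaleR_conv_of_real[where 'a = complex])
  then show "hubbard_vec t U (r *\<^sub>R v) = r *\<^sub>R hubbard_vec t U v"
    by (simp add: hubbard_vec_def vec_eq_iff hubbard_scale scaleR_conv_of_real[where 'a = complex])
qed

lemma hubbard_vec_selfadjoint:
  assumes "\<forall>x y. t x y = t y x"
  shows "hubbard_vec t U v \<bullet> w = v \<bullet> hubbard_vec t U w"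
  using hubbard_selfadjoint[OF assms, of "vec_nth v" U "vec_nth w"]
  by (simp add: hubbard_vec_def inner_vec_def fock_inner_def)

lemma hubbard_vec_eigen_iff:
  "hubbard_vec t U v = E *\<^sub>R v \<longleftrightarrow> hubbard t U (vec_nth v) = (\<lambda>S. of_real E * v $ S)"
  by (simp add: hubbard_vec_def vec_eq_iff fun_eq_iff scaleR_conv_of_real[where 'a = complex])

lemma finite_sector_eigvals:
  assumes "\<forall>x y. t x y = t y x"
  shows "finite (sector_eigvals (hubbard t U) N)"
proof (rule finite_subset)
  show "finite {l. \<exists>v. v \<noteq> 0 \<and> hubbard_vec t U v = l *\<^sub>R v}"
    by (rule finite_selfadjoint_eigenvalues) (rule hubbard_vec_selfadjoint[OF assms])
  show "sector_eigvals (hubbard t U) N \<subseteq> {l. \<exists>v. v \<noteq> 0 \<and> hubbard_vec t U v = l *\<^sub>R v}"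
  proof
    fix E assume "E \<in> sector_eigvals (hubbard t U) N"
    then obtain \<psi> where "\<psi> \<noteq> (\<lambda>_. 0)" "hubbard t U \<psi> = (\<lambda>S. of_real E * \<psi> S)"
      by (auto simp: sector_eigvals_def)
    then have "vec_lambda \<psi> \<noteq> 0 \<and> hubbard_vec t U (vec_lambda \<psi>) = E *\<^sub>R vec_lambda \<psi>"
      unfolding hubbard_vec_eigen_iff by (auto simp: vec_lambda_inverse vec_eq_iff)
    then show "E \<in> {l. \<exists>v. v \<noteq> 0 \<and> hubbard_vec t U v = l *\<^sub>R v}" by blast
  qed
qed

text \<open>The bound on \<open>N\<close> is the number of modes, so some configuration has
  \<open>N\<close> electrons and the sector is nonzero; minimizing the energy there yields an
  eigenvector. Hence the minimum in \<open>ground_energy\<close> is attained.\<close>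

lemma sector_eigvals_nonempty:
  fixes t :: "'x::{finite,linorder} \<Rightarrow> 'x \<Rightarrow> real"
  assumes sym: "\<forall>x y. t x y = t y x" and N: "N \<le> 2 * card (UNIV :: 'x set)"
  shows "sector_eigvals (hubbard t U) N \<noteq> {}"
proof -
  let ?W = "{v. vec_nth v \<in> sector N} :: (complex ^ (('x \<times> spin) set)) set"
  have "card (UNIV :: ('x \<times> spin) set) = 2 * card (UNIV :: 'x set)"
    by (simp add: card_cartesian_product UNIV_Times_UNIV[symmetric] UNIV_spin del: UNIV_Times_UNIV)
  then obtain T :: "('x \<times> spin) set" where T: "card T = N"
    using obtain_subset_with_card_n[of N "UNIV :: ('x \<times> spin) set"] N by auto
  have W: "subspace ?W" by (force simp: subspace_def sector_iff)
  have inv: "hubbard_vec t U ` ?W \<subseteq> ?W"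
    using hubbard_sector[of _ N t U] by (auto simp: hubbard_vec_def vec_lambda_inverse)
  have a: "axis T 1 \<in> ?W" "axis T 1 \<noteq> (0 :: complex ^ (('x \<times> spin) set))"
    using T by (auto simp: sector_iff axis_def vec_eq_iff)
  obtain l v where "v \<in> ?W" "v \<noteq> 0" "hubbard_vec t U v = l *\<^sub>R v"
    by (rule selfadjoint_min_eigenvector[OF linear_hubbard_vec hubbard_vec_selfadjoint[OF sym] W inv a])
  then have "l \<in> sector_eigvals (hubbard t U) N"
    unfolding hubbard_vec_eigen_iff sector_eigvals_def
    by (auto intro!: bexI[of _ "vec_nth v"] simp: vec_eq_iff fun_eq_iff)
  then show ?thesis by blast
qed

lemma sector_eigvals_ge:
  assumes "\<forall>x y. t x y = t y x" "\<forall>x. U x > 0" and E: "E \<in> sector_eigvals (hubbard t U) N"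
  shows "real N * eps0 t \<le> E"
proof -
  obtain \<psi> where \<psi>: "\<psi> \<in> sector N" "\<psi> \<noteq> (\<lambda>_. 0)" "hubbard t U \<psi> = (\<lambda>S. of_real E * \<psi> S)"
    using E by (auto simp: sector_eigvals_def)
  have "real N * eps0 t * fock_inner \<psi> \<psi> \<le> E * fock_inner \<psi> \<psi>"
    using energy_lower_bound[OF assms(1,2) \<psi>(1)] by (simp add: \<psi>(3) fock_inner_scale_right)
  then show ?thesis using fock_inner_self_pos[OF \<psi>(2)] by simp
qed

section \<open>Quasi-local bases\<close>

text \<open>Passing \<open>cann m\<close> through both operators costs two signs, which cancel, and
  leaves a contact term at \<open>m1\<close>. This is how annihilation commutes past spin
  lowering.\<close>

lemma cann_hop:
  "cann m (cdag m1 (cann m2 \<psi>)) S =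
    cdag m1 (cann m2 (cann m \<psi>)) S + (if m = m1 then cann m2 \<psi> S else 0)"
proof -
  have "cann m (cann m2 \<psi>) = (\<lambda>S. (-1) * cann m2 (cann m \<psi>) S)"
    using cann_anticommute[of m m2 \<psi>] by (simp add: fun_eq_iff)
  then have "cdag m1 (cann m (cann m2 \<psi>)) S = (-1) * cdag m1 (cann m2 (cann m \<psi>)) S"
    by (simp only: cdag_scale)
  then show ?thesis by (simp add: cann_cdag)
qed

lemma cann_sum: "cann m (\<lambda>S. \<Sum>i\<in>I. c i * g i S) = (\<lambda>S. \<Sum>i\<in>I. c i * cann m (g i) S)"
  by (auto simp: cann_def sum_distrib_left mult.left_commute)

lemma cdag_sum: "cdag m (\<lambda>S. \<Sum>i\<in>I. c i * g i S) = (\<lambda>S. \<Sum>i\<in>I. c i * cdag m (g i) S)"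
  by (auto simp: cdag_def sum_distrib_left mult.left_commute)

section \<open>Spin lowering\<close>

text \<open>When \<open>S\<close> contains \<open>(x,Dn)\<close> but not \<open>(x,Up)\<close>, this
  is the configuration that lowering the spin at \<open>x\<close> turns into
  \<open>S\<close>.\<close>

definition flip_up :: "'x \<Rightarrow> ('x \<times> spin) set \<Rightarrow> ('x \<times> spin) set" where
  "flip_up x S = insert (x,Up) (S - {(x,Dn)})"

text \<open>A spin flip moves no electron past another one, hence there is no sign.\<close>

lemma spin_flip_apply:
  "cdag (x,Dn) (cann (x,Up) \<psi>) S = (if (x,Dn) \<in> S \<and> (x,Up) \<notin> S then \<psi> (flip_up x S) else 0)"
  using fsign_Dn_eq_Up[of x "S - {(x,Dn)}"] by (auto simp: cdag_def cann_def flip_up_def)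

lemma Sminus_apply:
  "Sminus \<phi> C \<psi> S = (\<Sum>x\<in>support_sites \<phi> C. if (x,Dn) \<in> S \<and> (x,Up) \<notin> S then \<psi> (flip_up x S) else 0)"
  by (simp add: Sminus_def spin_flip_apply)

text \<open>A flip at \<open>y\<close> requires \<open>(y,Up)\<close> to be absent from
  \<open>S\<close>, so it happens away from the doubly occupied site, which is doubly occupied
  before the flip too.\<close>

lemma no_double_Sminus:
  fixes \<psi> :: "'x::{finite,linorder} fock"
  assumes "no_double \<psi>"
  shows "no_double (Sminus \<phi> C \<psi>)"
  unfolding no_double_def
proof (intro allI impI)
  fix S :: "('x \<times> spin) set" and x assume S: "(x,Up) \<in> S" "(x,Dn) \<in> S"
  have "\<psi> (flip_up y S) = 0" if "(y,Up) \<notin> S" for y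
  proof -
    have "(x,Up) \<in> flip_up y S" "(x,Dn) \<in> flip_up y S" using S that by (auto simp: flip_up_def)
    then show ?thesis using assms by (auto simp: no_double_def)
  qed
  then show "Sminus \<phi> C \<psi> S = 0" by (auto simp: Sminus_apply intro!: sum.neutral)
qed

lemma Sminus_sector:
  fixes \<psi> :: "'x::{finite,linorder} fock"
  assumes "\<psi> \<in> sector N"
  shows "Sminus \<phi> C \<psi> \<in> sector N"
proof -
  have "card (flip_up x S) = card S" if "(x,Dn) \<in> S" "(x,Up) \<notin> S" for x and S :: "('x \<times> spin) set"
    using that card_Suc_Diff1[of S "(x,Dn)"] by (simp add: flip_up_def)
  then have "Sminus \<phi> C \<psi> S = 0" if "card S \<noteq> N" for S
    using that by (auto simp: Sminus_apply intro!: sum.neutral sectorD[OF assms])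
  then show ?thesis by (auto simp: sector_iff)
qed

section \<open>Connected components and exchanges along paths\<close>

lemma comp_of_self: "u \<in> comp_of \<phi> A u"
  by (simp add: comp_of_def)

lemma comp_of_subset: "u \<in> A \<Longrightarrow> comp_of \<phi> A u \<subseteq> A"
proof
  fix v assume "u \<in> A" "v \<in> comp_of \<phi> A u"
  then have "(u, v) \<in> {(a, b). a \<in> A \<and> b \<in> A \<and> dconn \<phi> a b}\<^sup>*" by (simp add: comp_of_def)
  then show "v \<in> A" using \<open>u \<in> A\<close> by (induction rule: rtrancl_induct) auto
qed

lemma comp_of_eq:
  assumes "v \<in> comp_of \<phi> A u"
  shows "comp_of \<phi> A v = comp_of \<phi> A u"
proof -
  let ?R = "{(a, b). a \<in> A \<and> b \<in> A \<and> dconn \<phi> a b}"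
  have uv: "(u, v) \<in> ?R\<^sup>*" using assms by (simp add: comp_of_def)
  have "sym ?R" by (auto simp: sym_def dconn_def)
  then have vu: "(v, u) \<in> ?R\<^sup>*" using uv by (meson sym_rtrancl symE)
  show ?thesis unfolding comp_of_def using uv vu by (auto intro: rtrancl_trans)
qed

lemma comps_subset: "C \<in> comps \<phi> A \<Longrightarrow> C \<subseteq> A"
  unfolding comps_def by (elim imageE) (simp add: comp_of_subset)

lemma comp_of_comps: "C \<in> comps \<phi> A \<Longrightarrow> v \<in> C \<Longrightarrow> comp_of \<phi> A v = C"
  unfolding comps_def by (elim imageE) (simp add: comp_of_eq)

lemma comps_closed: "C \<in> comps \<phi> A \<Longrightarrow> v \<in> C \<Longrightarrow> u \<in> A \<Longrightarrow> dconn \<phi> v u \<Longrightarrow> u \<in> C"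
proof -
  assume C: "C \<in> comps \<phi> A" and v: "v \<in> C" and u: "u \<in> A" "dconn \<phi> v u"
  have "v \<in> A" using comps_subset[OF C] v by blast
  then have "u \<in> comp_of \<phi> A v" using u by (auto simp: comp_of_def)
  moreover have "comp_of \<phi> A v = C" using C v by (rule comp_of_comps)
  ultimately show ?thesis by simp
qed

lemma comps_disjoint: "C \<in> comps \<phi> A \<Longrightarrow> C' \<in> comps \<phi> A \<Longrightarrow> u \<in> C \<Longrightarrow> u \<in> C' \<Longrightarrow> C = C'"
  using comp_of_comps by metis

text \<open>An intermediate index \<open>v\<close> may itself lie in \<open>D\<close>. If it does,
  \<open>v\<close> is first moved on to \<open>w\<close>, and then \<open>u\<close> takes its place;
  otherwise \<open>u\<close> moves to \<open>v\<close> and then to \<open>w\<close>. The resulting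
  set is the same.\<close>

lemma move_along_path:
  fixes g :: "'v set \<Rightarrow> 'b"
  assumes R: "R \<subseteq> A \<times> A"
    and edge: "\<And>D u v. D \<subseteq> A \<Longrightarrow> (u, v) \<in> R \<Longrightarrow> u \<in> D \<Longrightarrow> v \<notin> D \<Longrightarrow> g (insert v (D - {u})) = g D"
    and path: "(u, v) \<in> R\<^sup>*" and D: "D \<subseteq> A" "u \<in> D" "v \<notin> D"
  shows "g (insert v (D - {u})) = g D"
  using path D
proof (induction arbitrary: D rule: rtrancl_induct)
  case (step v w)
  have vw: "v \<in> A" "w \<in> A" using step.hyps(2) R by auto
  show ?case
  proof (cases "v \<in> D")
    case True
    have 1: "g (insert w (D - {v})) = g D" using edge step.hyps(2) step.prems True by blast
    show ?thesis
    proof (cases "u = v")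
      case False
      let ?D = "insert w (D - {v})"
      have "g (insert v (?D - {u})) = g ?D"
        using step.prems vw True False by (intro step.IH) auto
      moreover have "insert v (?D - {u}) = insert w (D - {u})" using True False step.prems by auto
      ultimately show ?thesis using 1 by simp
    qed (use 1 in simp)
  next
    case False
    let ?D = "insert v (D - {u})"
    have 1: "g ?D = g D" using step.prems False by (intro step.IH) auto
    show ?thesis
    proof (cases "w = v")
      case wv: False
      have "g (insert w (?D - {v})) = g ?D"
        using step.prems vw wv by (intro edge step.hyps(2)) auto
      moreover have "insert w (?D - {v}) = insert w (D - {u})" using False by auto
      ultimately show ?thesis using 1 by simp
    qed (use 1 in simp)
  qed
qed simp

text \<open>For \<open>u\<close> in \<open>D - D'\<close>, equal counts in the component of
  \<open>u\<close> supply some \<open>v\<close> in \<open>D' - D\<close> from the same component.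
  Exchanging \<open>u\<close> for \<open>v\<close> along a path keeps all counts and
  \<open>g\<close>, and shrinks \<open>D - D'\<close>. Once \<open>D\<close> is a subset of
  \<open>D'\<close>, equal counts force equality.\<close>

lemma component_counts_determine:
  fixes g :: "'v::finite set \<Rightarrow> 'b"
  assumes edge: "\<And>D u v. D \<subseteq> A \<Longrightarrow> v \<in> A \<Longrightarrow> dconn \<phi> u v \<Longrightarrow> u \<in> D \<Longrightarrow> v \<notin> D \<Longrightarrow>
      g (insert v (D - {u})) = g D"
    and "D \<subseteq> A" "D' \<subseteq> A" "\<forall>C\<in>comps \<phi> A. card (D \<inter> C) = card (D' \<inter> C)"
  shows "g D = g D'"
  using assms(2-)
proof (induction "card (D - D')" arbitrary: D rule: less_induct)
  case less
  have cover: "u \<in> comp_of \<phi> A u" "comp_of \<phi> A u \<in> comps \<phi> A" if "u \<in> A" for u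
    using that by (auto simp: comp_of_self comps_def)
  show ?case
  proof (cases "D \<subseteq> D'")
    case True
    have "D' \<subseteq> D"
    proof
      fix u assume u: "u \<in> D'"
      let ?C = "comp_of \<phi> A u"
      have C: "u \<in> ?C" "?C \<in> comps \<phi> A" using cover less.prems u by blast+
      have "D \<inter> ?C = D' \<inter> ?C" using True C less.prems by (intro card_subset_eq) auto
      then show "u \<in> D" using u C by blast
    qed
    then show ?thesis using True by simp
  next
    case False
    then obtain u where u: "u \<in> D" "u \<notin> D'" by blast
    let ?C = "comp_of \<phi> A u"
    have C: "u \<in> ?C" "?C \<in> comps \<phi> A" using cover less.prems u by blast+
    have "\<not> D' \<inter> ?C \<subseteq> D \<inter> ?C"
    proof
      assume "D' \<inter> ?C \<subseteq> D \<inter> ?C"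
      then have "D' \<inter> ?C = D \<inter> ?C" using C less.prems by (intro card_subset_eq) auto
      then show False using u C by blast
    qed
    then obtain v where v: "v \<in> D'" "v \<in> ?C" "v \<notin> D" by blast
    let ?D = "insert v (D - {u})"
    have "g ?D = g D"
    proof (rule move_along_path[where g = g and A = A])
      show "(u, v) \<in> {(a, b). a \<in> A \<and> b \<in> A \<and> dconn \<phi> a b}\<^sup>*" using v by (simp add: comp_of_def)
    qed (use less.prems u v edge in auto)
    moreover have "g ?D = g D'"
    proof (rule less.hyps)
      have "?D - D' = (D - D') - {u}" using u v by auto
      then show "card (?D - D') < card (D - D')" using u by (simp only: card_Diff1_less[of "D - D'" u] finite Diff_iff simp_thms)
      show "?D \<subseteq> A" "D' \<subseteq> A" using less.prems v by auto
      show "\<forall>C\<in>comps \<phi> A. card (?D \<inter> C) = card (D' \<inter> C)"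
      proof
        fix C' assume C': "C' \<in> comps \<phi> A"
        have "card (?D \<inter> C') = card (D \<inter> C')"
        proof (cases "C' = ?C")
          case True
          have "?D \<inter> C' = insert v ((D \<inter> C') - {u})" using True u v by auto
          then show ?thesis using True u v C card_Suc_Diff1[of "D \<inter> C'" u] by simp
        next
          case False
          then have "u \<notin> C'" "v \<notin> C'" using comps_disjoint[OF C' C(2)] C v by blast+
          then have "?D \<inter> C' = D \<inter> C'" by auto
          then show ?thesis by simp
        qed
        then show "card (?D \<inter> C') = card (D' \<inter> C')" using less.prems C' by simp
      qed
    qed
    ultimately show ?thesis by simp
  qed
qed

section \<open>Linear spans\<close>

lemma in_cspan_zero: "in_cspan G (\<lambda>_. 0)"
  unfolding in_cspan_def by (intro exI[of _ "{}"]) auto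

lemma in_cspan_add:
  assumes "in_cspan G \<psi>" and g: "g \<in> G"
  shows "in_cspan G (\<lambda>S. \<psi> S + a * g S)"
proof -
  obtain F c where F: "finite F" "F \<subseteq> G" and \<psi>: "\<psi> = (\<lambda>S. \<Sum>h\<in>F. c h * h S)"
    using assms(1) unfolding in_cspan_def by blast
  define c' where "c' h = (if h \<in> F then c h else 0) + (if h = g then a else 0)" for h
  have "\<psi> S + a * g S = (\<Sum>h\<in>insert g F. c' h * h S)" for S
  proof -
    have "(\<Sum>h\<in>insert g F. c' h * h S) =
        (\<Sum>h\<in>insert g F. (if h \<in> F then c h else 0) * h S) + (\<Sum>h\<in>insert g F. (if h = g then a else 0) * h S)"
      unfolding c'_def distrib_right by (rule sum.distrib)
    also have "(\<Sum>h\<in>insert g F. (if h \<in> F then c h else 0) * h S) = \<psi> S"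
      unfolding \<psi> using F(1) by (intro sum.mono_neutral_cong_right) auto
    also have "(\<Sum>h\<in>insert g F. (if h = g then a else 0) * h S) = (\<Sum>h\<in>{g}. a * h S)"
      using F(1) by (intro sum.mono_neutral_cong_right) auto
    finally show ?thesis by simp
  qed
  then show ?thesis
    unfolding in_cspan_def using F g by (intro exI[of _ "insert g F"] exI[of _ c']) auto
qed

section \<open>Expansion at the special sites\<close>

text \<open>This is B1 with the special sites chosen as a function \<open>xs\<close>; B0 and B2 are
  assumed in the lemmas where they enter.\<close>

locale local_basis =
  fixes \<phi> :: "'v::{finite,linorder} \<Rightarrow> 'x::{finite,linorder} \<Rightarrow> complex" and xs :: "'v \<Rightarrow> 'x"
  assumes phi_site: "\<phi> u (xs u) \<noteq> 0" and phi_site_other: "v \<noteq> u \<Longrightarrow> \<phi> v (xs u) = 0"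
begin

lemma phi_site_iff: "\<phi> v (xs u) \<noteq> 0 \<longleftrightarrow> v = u"
  using phi_site phi_site_other by blast

lemma xs_eq_iff [simp]: "xs u = xs v \<longleftrightarrow> u = v"
  using phi_site_iff by metis

text \<open>Rescaling makes the basis dual to evaluation at the special sites.\<close>

definition weight :: "'v \<Rightarrow> 'x \<Rightarrow> complex" where
  "weight u x = \<phi> u x / \<phi> u (xs u)"

lemma weight_site: "weight u (xs v) = (if u = v then 1 else 0)"
  by (simp add: weight_def phi_site phi_site_other)

lemma weight_nonzero_iff: "weight u x \<noteq> 0 \<longleftrightarrow> \<phi> u x \<noteq> 0"
  by (simp add: weight_def phi_site)

text \<open>Evaluation at \<open>xs v\<close> isolates the coefficient of \<open>\<phi> v\<close>,
  so a function in the span is determined by its values on the special sites.\<close>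

lemma span_expand:
  assumes "\<And>x. f x = (\<Sum>u\<in>UNIV. c u * \<phi> u x)"
  shows "f x = (\<Sum>u\<in>UNIV. weight u x * f (xs u))"
proof -
  have "f (xs v) = (\<Sum>u\<in>UNIV. if u = v then c u * \<phi> u (xs u) else 0)" for v
    unfolding assms by (rule sum.cong) (auto simp: phi_site_other)
  then show ?thesis by (simp add: weight_def assms[of x] phi_site mult.commute)
qed

text \<open>Every vector of annihilation amplitudes lies in the span of the \<open>\<phi> u\<close>
  with \<open>u\<close> in \<open>A\<close>, the coefficients being read off at the special sites.
  For \<open>A = UNIV\<close> and under B0 this is membership in \<open>H0 t\<close>; smaller
  \<open>A\<close> records which indices a state is built from.\<close>

definition expands :: "'v set \<Rightarrow> 'x fock \<Rightarrow> bool" where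
  "expands A \<psi> \<longleftrightarrow>
    (\<forall>\<sigma> S x. cann (x,\<sigma>) \<psi> S = (\<Sum>u\<in>A. weight u x * cann (xs u,\<sigma>) \<psi> S))"

lemma expandsD: "expands A \<psi> \<Longrightarrow> cann (x,\<sigma>) \<psi> S = (\<Sum>u\<in>A. weight u x * cann (xs u,\<sigma>) \<psi> S)"
  unfolding expands_def by blast

text \<open>The functions of indices in \<open>A\<close> vanish at \<open>xs u\<close> for
  \<open>u\<close> outside \<open>A\<close>, so the additional summands are zero.\<close>

lemma expands_mono:
  assumes "expands A \<psi>" "A \<subseteq> B"
  shows "expands B \<psi>"
  unfolding expands_def
proof (intro allI)
  fix \<sigma> S x
  have "cann (xs u,\<sigma>) \<psi> S = 0" if "u \<notin> A" for u
    using that by (subst expandsD[OF assms(1)]) (auto simp: weight_site intro!: sum.neutral)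
  then show "cann (x,\<sigma>) \<psi> S = (\<Sum>u\<in>B. weight u x * cann (xs u,\<sigma>) \<psi> S)"
    using assms(2) by (subst expandsD[OF assms(1)]) (auto intro!: sum.mono_neutral_left)
qed

lemma expands_linear:
  assumes "expands A \<psi>" "expands A \<xi>"
  shows "expands A (\<lambda>S. \<psi> S + c * \<xi> S)"
  unfolding expands_def cann_add cann_scale
  by (subst expandsD[OF assms(1)], subst expandsD[OF assms(2)])
    (simp add: distrib_left sum.distrib sum_distrib_left mult.left_commute)

text \<open>If \<open>\<phi> u\<close> is nonzero at a site of the support of \<open>C\<close>, then
  \<open>u\<close> is directly connected to a member of \<open>C\<close>, and components are closed
  under such connections.\<close>

lemma support_site_iff:
  assumes "C \<in> comps \<phi> A" "u \<in> A" "\<phi> u x \<noteq> 0"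
  shows "x \<in> support_sites \<phi> C \<longleftrightarrow> u \<in> C"
  using assms comps_closed[OF assms(1) _ assms(2)] by (auto simp: support_sites_def dconn_def)

lemma site_support_iff: "xs u \<in> support_sites \<phi> C \<longleftrightarrow> u \<in> C"
  by (auto simp: support_sites_def phi_site_iff)

text \<open>The lowering operator commutes with annihilation up to a contact term on the support of
  \<open>C\<close>. That term expands too: where \<open>weight u x\<close> is nonzero,
  \<open>x\<close> and \<open>xs u\<close> both lie in the support or both lie outside.\<close>

lemma expands_Sminus:
  assumes C: "C \<in> comps \<phi> A" and ex: "expands A \<psi>"
  shows "expands A (Sminus \<phi> C \<psi>)"
  unfolding expands_def
proof (intro allI)
  fix \<sigma> S x
  let ?L = "support_sites \<phi> C"
  let ?h = "\<lambda>y. cdag (y,Dn) (cann (y,Up) \<psi>)"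
  have cS: "cann (x,\<sigma>) (Sminus \<phi> C \<psi>) S =
      (\<Sum>y\<in>?L. cdag (y,Dn) (cann (y,Up) (cann (x,\<sigma>) \<psi>)) S) +
      (if \<sigma> = Dn \<and> x \<in> ?L then cann (x,Up) \<psi> S else 0)" for x
  proof -
    have "cann (x,\<sigma>) (Sminus \<phi> C \<psi>) S = (\<Sum>y\<in>?L. cann (x,\<sigma>) (?h y) S)"
      using cann_sum[of "(x,\<sigma>)" "\<lambda>_. 1" ?h ?L] by (simp add: Sminus_def)
    also have "\<dots> = (\<Sum>y\<in>?L. cdag (y,Dn) (cann (y,Up) (cann (x,\<sigma>) \<psi>)) S) +
        (\<Sum>y\<in>?L. if (x,\<sigma>) = (y,Dn) then cann (y,Up) \<psi> S else 0)"
      unfolding cann_hop by (rule sum.distrib)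
    also have "(\<Sum>y\<in>?L. if (x,\<sigma>) = (y,Dn) then cann (y,Up) \<psi> S else 0) =
        (if \<sigma> = Dn \<and> x \<in> ?L then cann (x,Up) \<psi> S else 0)"
      by (cases "\<sigma> = Dn") (simp_all add: sum.delta')
    finally show ?thesis .
  qed
  have "(\<Sum>y\<in>?L. cdag (y,Dn) (cann (y,Up) (cann (x,\<sigma>) \<psi>)) S) =
      (\<Sum>y\<in>?L. \<Sum>u\<in>A. weight u x * cdag (y,Dn) (cann (y,Up) (cann (xs u,\<sigma>) \<psi>)) S)"
  proof -
    have "cann (x,\<sigma>) \<psi> = (\<lambda>S. \<Sum>u\<in>A. weight u x * cann (xs u,\<sigma>) \<psi> S)"
      using expandsD[OF ex] by blast
    then show ?thesis by (simp only: cann_sum cdag_sum)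
  qed
  also have "\<dots> = (\<Sum>u\<in>A. weight u x * (\<Sum>y\<in>?L. cdag (y,Dn) (cann (y,Up) (cann (xs u,\<sigma>) \<psi>)) S))"
    unfolding sum_distrib_left by (rule sum.swap)
  finally have 1: "(\<Sum>y\<in>?L. cdag (y,Dn) (cann (y,Up) (cann (x,\<sigma>) \<psi>)) S) = \<dots>" .
  have "(if x \<in> ?L then cann (x,Up) \<psi> S else 0) =
      (\<Sum>u\<in>A. if x \<in> ?L then weight u x * cann (xs u,Up) \<psi> S else 0)"
    using expandsD[OF ex, of x Up S] by simp
  also have "\<dots> = (\<Sum>u\<in>A. weight u x * (if xs u \<in> ?L then cann (xs u,Up) \<psi> S else 0))"
  proof (rule sum.cong[OF refl])
    fix u assume "u \<in> A"
    then show "(if x \<in> ?L then weight u x * cann (xs u,Up) \<psi> S else 0) =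
        weight u x * (if xs u \<in> ?L then cann (xs u,Up) \<psi> S else 0)"
      using support_site_iff[OF C, of u x] site_support_iff[of u C] weight_nonzero_iff[of u x]
      by (cases "weight u x = 0") auto
  qed
  finally have 2: "(if \<sigma> = Dn \<and> x \<in> ?L then cann (x,Up) \<psi> S else 0) =
      (\<Sum>u\<in>A. weight u x * (if \<sigma> = Dn \<and> xs u \<in> ?L then cann (xs u,Up) \<psi> S else 0))"
    by (cases "\<sigma> = Dn") simp_all
  show "cann (x,\<sigma>) (Sminus \<phi> C \<psi>) S = (\<Sum>u\<in>A. weight u x * cann (xs u,\<sigma>) (Sminus \<phi> C \<psi>) S)"
    unfolding cS 1 2 by (simp add: distrib_left sum.distrib)
qed

text \<open>The anticommutator contributes a multiple of \<open>\<phi> u\<close>, which has the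
  required expansion because \<open>u\<close> is in \<open>A\<close>.\<close>

lemma expands_adag:
  assumes "u \<in> A" and ex: "expands A \<psi>"
  shows "expands A (adag \<phi> u Up \<psi>)"
  unfolding expands_def
proof (intro allI)
  fix \<sigma> S x
  have ca: "cann (x,\<sigma>) (adag \<phi> u Up \<psi>) S =
      (if \<sigma> = Up then \<phi> u x * \<psi> S else 0) - (\<Sum>y\<in>UNIV. \<phi> u y * cdag (y,Up) (cann (x,\<sigma>) \<psi>) S)" for x
  proof -
    have "cann (x,\<sigma>) (adag \<phi> u Up \<psi>) S =
        (\<Sum>y\<in>UNIV. \<phi> u y * (if (x,\<sigma>) = (y,Up) then \<psi> S else 0)) -
        (\<Sum>y\<in>UNIV. \<phi> u y * cdag (y,Up) (cann (x,\<sigma>) \<psi>) S)"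
      unfolding adag_def cann_sum cann_cdag right_diff_distrib by (rule sum_subtractf)
    also have "(\<Sum>y\<in>UNIV. \<phi> u y * (if (x,\<sigma>) = (y,Up) then \<psi> S else 0)) =
        (if \<sigma> = Up then \<phi> u x * \<psi> S else 0)"
      by (cases "\<sigma> = Up") (simp_all add: if_distrib[of "\<lambda>z. _ * z"] sum.delta' cong: if_cong)
    finally show ?thesis .
  qed
  have "(\<Sum>v\<in>A. weight v x * \<phi> u (xs v)) = (\<Sum>v\<in>A. if v = u then \<phi> u x else 0)"
    by (rule sum.cong) (auto simp: weight_def phi_site phi_site_other)
  then have "\<phi> u x = (\<Sum>v\<in>A. weight v x * \<phi> u (xs v))" using assms(1) by simp
  then have 1: "(if \<sigma> = Up then \<phi> u x * \<psi> S else 0) =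
      (\<Sum>v\<in>A. weight v x * (if \<sigma> = Up then \<phi> u (xs v) * \<psi> S else 0))"
    by (simp add: sum_distrib_right mult.assoc)
  have "cann (x,\<sigma>) \<psi> = (\<lambda>S. \<Sum>v\<in>A. weight v x * cann (xs v,\<sigma>) \<psi> S)"
    using expandsD[OF ex] by blast
  then have "(\<Sum>y\<in>UNIV. \<phi> u y * cdag (y,Up) (cann (x,\<sigma>) \<psi>) S) =
      (\<Sum>y\<in>UNIV. \<Sum>v\<in>A. weight v x * (\<phi> u y * cdag (y,Up) (cann (xs v,\<sigma>) \<psi>) S))"
    by (simp only: cdag_sum sum_distrib_left mult.left_commute)
  also have "\<dots> = (\<Sum>v\<in>A. weight v x * (\<Sum>y\<in>UNIV. \<phi> u y * cdag (y,Up) (cann (xs v,\<sigma>) \<psi>) S))"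
    unfolding sum_distrib_left by (rule sum.swap)
  finally have 2: "(\<Sum>y\<in>UNIV. \<phi> u y * cdag (y,Up) (cann (x,\<sigma>) \<psi>) S) = \<dots>" .
  show "cann (x,\<sigma>) (adag \<phi> u Up \<psi>) S = (\<Sum>v\<in>A. weight v x * cann (xs v,\<sigma>) (adag \<phi> u Up \<psi>) S)"
    unfolding ca 1 2 by (simp add: right_diff_distrib sum_subtractf)
qed

text \<open>Expanding in the coordinates \<open>xs u\<close> moves electrons onto the special sites one by one.\<close>

lemma expands_eq_zero:
  assumes ex: "expands UNIV \<psi>" and zero: "\<And>S. S \<subseteq> range xs \<times> UNIV \<Longrightarrow> \<psi> S = 0"
  shows "\<psi> S = 0"
proof (induction "card {m \<in> S. fst m \<notin> range xs}" arbitrary: S rule: less_induct)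
  case less
  show ?case
  proof (cases "S \<subseteq> range xs \<times> UNIV")
    case False
    then obtain y \<sigma> where y: "(y,\<sigma>) \<in> S" "y \<notin> range xs" by auto
    let ?R = "S - {(y,\<sigma>)}"
    have "cann (xs u,\<sigma>) \<psi> ?R = 0" for u
    proof -
      have "{m \<in> insert (xs u,\<sigma>) ?R. fst m \<notin> range xs} = {m \<in> S. fst m \<notin> range xs} - {(y,\<sigma>)}"
        by auto
      moreover have "card ({m \<in> S. fst m \<notin> range xs} - {(y,\<sigma>)}) < card {m \<in> S. fst m \<notin> range xs}"
        by (rule card_Diff1_less) (use y in auto)
      ultimately have "\<psi> (insert (xs u,\<sigma>) ?R) = 0" by (intro less) (simp only:)
      then show ?thesis by (simp add: cann_def)
    qed
    then have "cann (y,\<sigma>) \<psi> ?R = 0" by (subst expandsD[OF ex]) simp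
    then show ?thesis using y by (simp add: cann_def insert_absorb)
  qed (rule zero)
qed

section \<open>Configurations on the special sites\<close>

text \<open>\<open>A\<close> holds the occupied indices and \<open>D\<close> those with spin down;
  only the part of \<open>D\<close> inside \<open>A\<close> matters.\<close>

definition conf :: "'v set \<Rightarrow> 'v set \<Rightarrow> ('x \<times> spin) set" where
  "conf A D = (\<lambda>u. (xs u, if u \<in> D then Dn else Up)) ` A"

lemma conf_iff [simp]:
  "(xs u, Dn) \<in> conf A D \<longleftrightarrow> u \<in> A \<and> u \<in> D"
  "(xs u, Up) \<in> conf A D \<longleftrightarrow> u \<in> A \<and> u \<notin> D"
  by (auto simp: conf_def split: if_splits)

lemma conf_insert: "conf (insert u A) D = insert (xs u, if u \<in> D then Dn else Up) (conf A D)"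
  by (simp add: conf_def)

lemma conf_cong: "A \<inter> D = A \<inter> D' \<Longrightarrow> conf A D = conf A D'"
  unfolding conf_def by (rule image_cong) auto

lemma card_conf: "card (conf A D) = card A"
  unfolding conf_def by (intro card_image inj_onI) auto

lemma flip_up_conf:
  assumes "u \<in> A" "u \<in> D"
  shows "flip_up (xs u) (conf A D) = conf A (D - {u})"
proof -
  let ?R = "conf (A - {u}) D"
  have A: "insert u (A - {u}) = A" using assms by blast
  have "conf A D = insert (xs u, Dn) ?R"
    using conf_insert[of u "A - {u}" D] assms unfolding A by simp
  moreover have "conf A (D - {u}) = insert (xs u, Up) (conf (A - {u}) (D - {u}))"
    using conf_insert[of u "A - {u}" "D - {u}"] unfolding A by simp
  moreover have "conf (A - {u}) (D - {u}) = ?R" by (rule conf_cong) blast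
  moreover have "(xs u, Dn) \<notin> ?R" by simp
  ultimately show ?thesis by (simp add: flip_up_def)
qed

lemma single_occupancy_conf:
  assumes S: "S \<subseteq> range xs \<times> UNIV" and single: "\<And>x. \<not> ((x,Up) \<in> S \<and> (x,Dn) \<in> S)"
  obtains A D where "D \<subseteq> A" "S = conf A D"
proof
  let ?D = "{u. (xs u, Dn) \<in> S}" and ?A = "{u. xs u \<in> fst ` S}"
  show "?D \<subseteq> ?A" by force
  have mem: "(x,\<sigma>) \<in> S \<longleftrightarrow> (x,\<sigma>) \<in> conf ?A ?D" for x \<sigma>
  proof (cases "x \<in> range xs")
    case True
    then obtain u where u: "x = xs u" by auto
    have "u \<in> ?A \<longleftrightarrow> (x,Up) \<in> S \<or> (x,Dn) \<in> S"
    proof -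
      have "u \<in> ?A \<longleftrightarrow> (\<exists>\<sigma>. (x,\<sigma>) \<in> S)" unfolding u by force
      then show ?thesis by (simp only: ex_spin)
    qed
    then show ?thesis using single[of x] by (cases \<sigma>) (auto simp: u)
  qed (use S in \<open>auto simp: conf_def\<close>)
  show "S = conf ?A ?D"
  proof (rule set_eqI)
    fix p show "p \<in> S \<longleftrightarrow> p \<in> conf ?A ?D" by (cases p) (simp only: mem[symmetric])
  qed
qed

text \<open>No function with index in \<open>A\<close> reaches \<open>xs u\<close>, so annihilating
  the electron there gives zero.\<close>

lemma expands_conf_outside:
  assumes ex: "expands A \<psi>" and u: "u \<in> B" "u \<notin> A"
  shows "\<psi> (conf B D) = 0"
proof -
  let ?m = "(xs u, if u \<in> D then Dn else Up)"
  have m: "?m \<in> conf B D" using u by (simp add: conf_def)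
  have "cann ?m \<psi> (conf B D - {?m}) = 0"
    using u(2) by (subst expandsD[OF ex]) (auto simp: weight_site intro!: sum.neutral)
  then show ?thesis using m by (simp add: cann_def insert_absorb)
qed

text \<open>On these configurations spin lowering becomes a purely combinatorial operator on
  \<open>D\<close>: only the occupied down sites with index in \<open>C\<close> contribute, and a
  flip removes that index from \<open>D\<close>.\<close>

lemma Sminus_conf:
  assumes "D \<subseteq> A"
  shows "Sminus \<phi> C \<psi> (conf A D) = (\<Sum>u\<in>D \<inter> C. \<psi> (conf A (D - {u})))"
proof -
  let ?g = "\<lambda>x. if (x,Dn) \<in> conf A D \<and> (x,Up) \<notin> conf A D then \<psi> (flip_up x (conf A D)) else 0"
  have "Sminus \<phi> C \<psi> (conf A D) = sum ?g (support_sites \<phi> C)" by (rule Sminus_apply)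
  also have "\<dots> = sum ?g (xs ` (D \<inter> C))"
  proof (rule sum.mono_neutral_right)
    show "xs ` (D \<inter> C) \<subseteq> support_sites \<phi> C" by (auto simp: site_support_iff)
    show "\<forall>x\<in>support_sites \<phi> C - xs ` (D \<inter> C). ?g x = 0"
    proof
      fix x assume x: "x \<in> support_sites \<phi> C - xs ` (D \<inter> C)"
      show "?g x = 0"
      proof (cases "(x,Dn) \<in> conf A D")
        case True
        then obtain u where "x = xs u" "u \<in> D" by (auto simp: conf_def split: if_splits)
        then show ?thesis using x site_support_iff[of u C] by auto
      qed simp
    qed
  qed simp
  also have "\<dots> = (\<Sum>u\<in>D \<inter> C. ?g (xs u))"
    by (subst sum.reindex) (auto simp: inj_on_def)
  also have "\<dots> = (\<Sum>u\<in>D \<inter> C. \<psi> (conf A (D - {u})))"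
    using assms by (intro sum.cong) (auto simp: flip_up_conf)
  finally show ?thesis .
qed

section \<open>Amplitudes on the special sites\<close>

text \<open>On the special sites of \<open>A\<close> such a state is a product of Dicke states, one
  per component, with \<open>n C\<close> down spins each. If some \<open>n C\<close> exceeds
  \<open>card C\<close>, all these amplitudes are zero, so powers of the lowering operator can be
  handled without a bound on the exponent.\<close>

definition profile :: "'v set \<Rightarrow> ('v set \<Rightarrow> nat) \<Rightarrow> 'x fock \<Rightarrow> bool" where
  "profile A n \<psi> \<longleftrightarrow> no_double \<psi> \<and> expands A \<psi> \<and> \<psi> \<in> sector (card A) \<and>
    (\<exists>K. K \<noteq> 0 \<and> (\<forall>D\<subseteq>A. \<psi> (conf A D) = (if \<forall>C\<in>comps \<phi> A. card (D \<inter> C) = n C then K else 0)))"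

lemma profile_cong:
  assumes "\<And>C. C \<in> comps \<phi> A \<Longrightarrow> n C = n' C"
  shows "profile A n \<psi> \<longleftrightarrow> profile A n' \<psi>"
  using assms by (simp add: profile_def)

text \<open>A configuration with \<open>Suc (n C)\<close> down spins in \<open>C\<close> receives
  the amplitude \<open>K\<close> once for each of them, so the new constant is
  \<open>of_nat (Suc (n C)) * K\<close>, again nonzero.\<close>

lemma profile_Sminus:
  assumes C: "C \<in> comps \<phi> A" and p: "profile A n \<psi>"
  shows "profile A (n(C := Suc (n C))) (Sminus \<phi> C \<psi>)"
proof -
  let ?n = "n(C := Suc (n C))"
  obtain K where K: "K \<noteq> 0"
    and val: "\<And>D. D \<subseteq> A \<Longrightarrow> \<psi> (conf A D) = (if \<forall>C\<in>comps \<phi> A. card (D \<inter> C) = n C then K else 0)"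
    using p unfolding profile_def by blast
  have "Sminus \<phi> C \<psi> (conf A D) =
      (if \<forall>C\<in>comps \<phi> A. card (D \<inter> C) = ?n C then of_nat (Suc (n C)) * K else 0)" if D: "D \<subseteq> A" for D
  proof -
    have counts: "(\<forall>C'\<in>comps \<phi> A. card ((D - {u}) \<inter> C') = n C') \<longleftrightarrow>
        (\<forall>C'\<in>comps \<phi> A. card (D \<inter> C') = ?n C')" if u: "u \<in> D \<inter> C" for u
    proof (rule ball_cong[OF refl])
      fix C' assume C': "C' \<in> comps \<phi> A"
      show "card ((D - {u}) \<inter> C') = n C' \<longleftrightarrow> card (D \<inter> C') = ?n C'"
      proof (cases "C' = C")
        case True
        have "(D - {u}) \<inter> C = (D \<inter> C) - {u}" by blast
        then have "card (D \<inter> C) = Suc (card ((D - {u}) \<inter> C))" using u card_Suc_Diff1[of "D \<inter> C" u] by simp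
        then show ?thesis using True by simp
      next
        case False
        then have "u \<notin> C'" using comps_disjoint[OF C C'] u by blast
        then have "(D - {u}) \<inter> C' = D \<inter> C'" by blast
        then show ?thesis using False by simp
      qed
    qed
    have "Sminus \<phi> C \<psi> (conf A D) =
        (\<Sum>u\<in>D \<inter> C. if \<forall>C\<in>comps \<phi> A. card (D \<inter> C) = ?n C then K else 0)"
      unfolding Sminus_conf[OF D]
    proof (rule sum.cong[OF refl])
      fix u assume u: "u \<in> D \<inter> C"
      have "D - {u} \<subseteq> A" using D by blast
      then show "\<psi> (conf A (D - {u})) = (if \<forall>C\<in>comps \<phi> A. card (D \<inter> C) = ?n C then K else 0)"
        by (simp only: val counts[OF u])
    qed
    also have "\<dots> = of_nat (card (D \<inter> C)) *
        (if \<forall>C\<in>comps \<phi> A. card (D \<inter> C) = ?n C then K else 0)"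
      by (rule sum_constant)
    also have "\<dots> = (if \<forall>C\<in>comps \<phi> A. card (D \<inter> C) = ?n C then of_nat (Suc (n C)) * K else 0)"
    proof (cases "\<forall>C\<in>comps \<phi> A. card (D \<inter> C) = ?n C")
      case True
      then have "card (D \<inter> C) = Suc (n C)" using C by simp
      then show ?thesis unfolding if_P[OF True] by simp
    next
      case False
      then show ?thesis unfolding if_not_P[OF False] by simp
    qed
    finally show ?thesis .
  qed
  moreover have "of_nat (Suc (n C)) * K \<noteq> 0" using K by (metis mult_eq_0_iff of_nat_eq_0_iff old.nat.distinct(2))
  ultimately show ?thesis
    using p C unfolding profile_def by (blast intro: no_double_Sminus expands_Sminus Sminus_sector)
qed

lemma profile_Sminus_power:
  assumes "C \<in> comps \<phi> A" "profile A n \<psi>"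
  shows "profile A (n(C := n C + k)) ((Sminus \<phi> C ^^ k) \<psi>)"
proof (induction k)
  case (Suc k)
  have "(n(C := n C + k))(C := Suc ((n(C := n C + k)) C)) = n(C := n C + Suc k)" by simp
  then show ?case using profile_Sminus[OF assms(1) Suc] by (simp only: funpow.simps o_apply)
qed (use assms in simp)

lemma up_list_properties:
  assumes "distinct us"
  defines "\<psi> \<equiv> foldr (\<lambda>u \<psi>. adag \<phi> u Up \<psi>) us vac"
  shows "\<psi> \<in> sector (length us)" and "(x,Dn) \<in> S \<Longrightarrow> \<psi> S = 0"
    and "set us \<subseteq> A \<Longrightarrow> expands A \<psi>" and "\<psi> (conf (set us) {}) \<noteq> 0"
proof -
  let ?f = "\<lambda>us. foldr (\<lambda>u \<psi>. adag \<phi> u Up \<psi>) us vac"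
  have sec: "?f us \<in> sector (length us)" for us
  proof (induction us)
    case (Cons u us)
    have "adag \<phi> u Up (?f us) S = 0" if "card S \<noteq> Suc (length us)" for S
    proof -
      have "cdag (y,Up) (?f us) S = 0" for y
      proof (cases "(y,Up) \<in> S")
        case True
        then have "card (S - {(y,Up)}) \<noteq> length us" using that card_Suc_Diff1[OF finite True] by auto
        then have "?f us (S - {(y,Up)}) = 0" by (rule sectorD[OF Cons])
        then show ?thesis by (simp add: cdag_def)
      qed (simp add: cdag_def)
      then show ?thesis by (simp add: adag_def)
    qed
    then show ?case by (auto simp: sector_iff)
  qed (auto simp: sector_iff vac_def)
  then show "\<psi> \<in> sector (length us)" by (simp add: \<psi>_def)
  show "\<psi> S = 0" if "(x,Dn) \<in> S"
    using that unfolding \<psi>_def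
  proof (induction us arbitrary: S)
    case (Cons u us)
    then have "cdag (y,Up) (?f us) S = 0" for y by (simp add: cdag_def)
    then show ?case by (simp add: adag_def)
  qed (auto simp: vac_def)
  show "expands A \<psi>" if "set us \<subseteq> A"
    using that unfolding \<psi>_def
  proof (induction us)
    case Nil
    have "cann m vac S = 0" for m and S :: "('x \<times> spin) set" by (simp add: cann_def vac_def)
    then show ?case by (simp add: expands_def)
  qed (simp add: expands_adag)
  show "\<psi> (conf (set us) {}) \<noteq> 0"
    using assms(1) unfolding \<psi>_def
  proof (induction us)
    case (Cons u us)
    let ?S = "conf (set (u # us)) {}"
    \<comment> \<open>Every occupied site is special, and \<open>\<phi> u\<close> vanishes at all
      special sites but its own, so only \<open>xs u\<close> contributes.\<close>
    have "\<phi> u x * cdag (x,Up) (?f us) ?S = 0" if "x \<noteq> xs u" for x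
    proof (cases "(x,Up) \<in> ?S")
      case True
      then obtain v where "x = xs v" by (auto simp: conf_def)
      then show ?thesis using that by (simp add: phi_site_other)
    qed (simp add: cdag_def)
    then have "?f (u # us) ?S = (\<Sum>x\<in>{xs u}. \<phi> u x * cdag (x,Up) (?f us) ?S)"
      unfolding foldr.simps o_apply adag_def by (intro sum.mono_neutral_right) auto
    moreover have "?S - {(xs u, Up)} = conf (set us) {}"
      using Cons.prems by (auto simp: conf_def)
    ultimately show ?case using Cons by (simp add: cdag_def phi_site)
  qed (simp add: conf_def vac_def)
qed

text \<open>All spins are up, and since the components cover \<open>A\<close>, zero down spins in
  each component means that \<open>D\<close> is empty.\<close>

lemma profile_up_state: "profile A (\<lambda>_. 0) (up_state \<phi> A)"
proof -
  let ?us = "sorted_list_of_set A"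
  have us: "distinct ?us" "set ?us = A" "length ?us = card A" by simp_all
  note props = up_list_properties[OF us(1), folded up_state_def, unfolded us]
  have "(\<forall>C\<in>comps \<phi> A. card (D \<inter> C) = 0) \<longleftrightarrow> D = {}" if "D \<subseteq> A" for D
  proof
    assume 0: "\<forall>C\<in>comps \<phi> A. card (D \<inter> C) = 0"
    show "D = {}"
    proof (rule equals0I)
      fix u assume u: "u \<in> D"
      then have "comp_of \<phi> A u \<in> comps \<phi> A" using that by (auto simp: comps_def)
      then have "D \<inter> comp_of \<phi> A u = {}" using 0 by simp
      then show False using u comp_of_self[of u \<phi> A] by blast
    qed
  qed simp
  moreover have "up_state \<phi> A (conf A D) = 0" if D: "D \<subseteq> A" "D \<noteq> {}" for D
  proof -
    obtain u where "u \<in> D" using D by blast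
    then have "(xs u, Dn) \<in> conf A D" using D by auto
    then show ?thesis by (rule props)
  qed
  ultimately have val: "up_state \<phi> A (conf A D) =
      (if \<forall>C\<in>comps \<phi> A. card (D \<inter> C) = 0 then up_state \<phi> A (conf A {}) else 0)" if "D \<subseteq> A" for D
    using that by auto
  have "no_double (up_state \<phi> A)" unfolding no_double_def by (intro allI impI props(2))
  then show ?thesis
    unfolding profile_def
    by (intro conjI exI[of _ "up_state \<phi> A (conf A {})"] allI impI props(1,4) props(3)[OF subset_refl] val)
qed

lemma profile_Phi: "profile A (\<lambda>C. nat \<lfloor>real (card C) / 2 - m C\<rfloor>) (Phi \<phi> A m)"
proof -
  let ?j = "\<lambda>C. nat \<lfloor>real (card C) / 2 - m C\<rfloor>"
  let ?c = "comp_of \<phi> A"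
  let ?f = "\<lambda>us. foldr (\<lambda>u \<psi>. (Sminus \<phi> (?c u) ^^ ?j (?c u)) \<psi>) us (up_state \<phi> A)"
  \<comment> \<open>Components not yet treated by the partial list still have no down spins.\<close>
  have fold: "profile A (\<lambda>C. if C \<in> ?c ` set us then ?j C else 0) (?f us)"
    if "set us \<subseteq> A" "distinct us" "inj_on ?c (set us)" for us
    using that
  proof (induction us)
    case Nil
    then show ?case by (simp add: profile_up_state)
  next
    case (Cons u us)
    let ?n = "\<lambda>C. if C \<in> ?c ` set us then ?j C else 0"
    have u: "?c u \<in> comps \<phi> A" "?c u \<notin> ?c ` set us" using Cons.prems by (auto simp: comps_def)
    have "profile A ?n (?f us)" using Cons by auto
    then have "profile A (?n(?c u := ?n (?c u) + ?j (?c u))) (?f (u # us))"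
      using profile_Sminus_power[OF u(1), of ?n "?f us" "?j (?c u)"]
      by (simp only: foldr.simps o_apply)
    moreover have "?n(?c u := ?n (?c u) + ?j (?c u)) = (\<lambda>C. if C \<in> ?c ` set (u # us) then ?j C else 0)"
      using u(2) by (auto simp: fun_eq_iff)
    ultimately show ?case by simp
  qed
  \<comment> \<open>The least elements represent every component exactly once, so each exponent is
    applied once.\<close>
  let ?us = "filter (\<lambda>u. u = Min (?c u)) (sorted_list_of_set A)"
  have us: "set ?us = {u \<in> A. u = Min (?c u)}" by auto
  have inj: "inj_on ?c (set ?us)" unfolding us by (rule inj_onI) (metis (mono_tags, lifting) mem_Collect_eq)
  have "C \<in> ?c ` set ?us" if C: "C \<in> comps \<phi> A" for C
  proof -
    have "C \<noteq> {}" using C comp_of_self by (fastforce simp: comps_def)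
    then have "Min C \<in> C" by simp
    then have "?c (Min C) = C" "Min C \<in> A" using comp_of_comps[OF C] comps_subset[OF C] by auto
    then show ?thesis unfolding us by force
  qed
  then have "profile A ?j (?f ?us) \<longleftrightarrow> profile A (\<lambda>C. if C \<in> ?c ` set ?us then ?j C else 0) (?f ?us)"
    by (intro profile_cong) simp
  moreover have "profile A (\<lambda>C. if C \<in> ?c ` set ?us then ?j C else 0) (?f ?us)"
    by (rule fold) (use inj in auto)
  ultimately show ?thesis by (simp add: Phi_def)
qed

text \<open>Where \<open>\<phi> u\<close> and \<open>\<phi> v\<close> overlap, B2 says that no other basis function contributes, and the
  vanishing of \<open>c\<^bsub>x\<up>\<^esub> c\<^bsub>x\<down>\<^esub> \<psi>\<close> equates the two amplitudes with the spins at \<open>u\<close>, \<open>v\<close> exchanged.\<close>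

lemma spin_exchange:
  assumes b2: "B2 \<phi>" and nd: "no_double \<psi>" and ex: "expands UNIV \<psi>"
    and D: "D \<subseteq> A" "v \<in> A" "u \<in> D" "v \<notin> D" and uv: "dconn \<phi> u v"
  shows "\<psi> (conf A (insert v (D - {u}))) = \<psi> (conf A D)"
proof -
  have ne: "u \<noteq> v" using D by auto
  obtain x where x: "\<phi> u x \<noteq> 0" "\<phi> v x \<noteq> 0" using uv by (auto simp: dconn_def)
  have "{u, v} = {w. \<phi> w x \<noteq> 0}"
  proof (rule card_seteq)
    show "card {w. \<phi> w x \<noteq> 0} \<le> card {u, v}" using b2 ne by (simp add: B2_def numeral_2_eq_2)
  qed (use x in auto)
  then have w0: "weight w x = 0" if "w \<notin> {u, v}" for w
    using that weight_nonzero_iff[of w x] by blast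
  have two: "(\<Sum>w\<in>UNIV. weight w x * f w) = weight u x * f u + weight v x * f v" for f :: "'v \<Rightarrow> complex"
  proof -
    have "(\<Sum>w\<in>UNIV. weight w x * f w) = (\<Sum>w\<in>{u,v}. weight w x * f w)"
      using w0 by (intro sum.mono_neutral_right) auto
    then show ?thesis using ne by simp
  qed
  \<comment> \<open>\<open>R\<close> is the configuration without the electrons of \<open>u\<close>
    and \<open>v\<close>; up to sign, \<open>g a b\<close> is the amplitude with spin up put back at
    \<open>xs a\<close> and spin down at \<open>xs b\<close>.\<close>
  define R where "R = conf (A - {u, v}) D"
  define g where "g a b = cann (xs a,Up) (cann (xs b,Dn) \<psi>) R" for a b
  have double: "cann (y,Up) (cann (y,Dn) \<psi>) R = 0" for y
  proof -
    have "\<psi> (insert (y,Dn) (insert (y,Up) R)) = 0" by (rule no_doubleD[OF nd, of y]) auto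
    then show ?thesis by (simp add: cann_def)
  qed
  have inner: "cann (x,Up) (cann (xs b,Dn) \<psi>) R = weight u x * g u b + weight v x * g v b" for b
  proof -
    have e: "cann (x,Up) \<psi> = (\<lambda>S. \<Sum>w\<in>UNIV. weight w x * cann (xs w,Up) \<psi> S)"
      using expandsD[OF ex] by blast
    have "cann (x,Up) (cann (xs b,Dn) \<psi>) R = - cann (xs b,Dn) (cann (x,Up) \<psi>) R"
      by (rule cann_anticommute)
    also have "cann (xs b,Dn) (cann (x,Up) \<psi>) R = weight u x * cann (xs b,Dn) (cann (xs u,Up) \<psi>) R
        + weight v x * cann (xs b,Dn) (cann (xs v,Up) \<psi>) R"
      unfolding e cann_sum by (rule two)
    finally show ?thesis
      unfolding g_def cann_anticommute[of "(xs b,Dn)"] by (simp add: algebra_simps)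
  qed
  have e: "cann (x,Dn) \<psi> = (\<lambda>S. \<Sum>w\<in>UNIV. weight w x * cann (xs w,Dn) \<psi> S)"
    using expandsD[OF ex] by blast
  have "0 = cann (x,Up) (cann (x,Dn) \<psi>) R" by (simp add: double)
  also have "\<dots> = weight u x * (weight u x * g u u + weight v x * g v u)
      + weight v x * (weight u x * g u v + weight v x * g v v)"
    unfolding e cann_sum unfolding two inner ..
  \<comment> \<open>The terms \<open>g u u\<close> and \<open>g v v\<close> are double occupancies
    and vanish.\<close>
  also have "\<dots> = weight u x * weight v x * (g u v + g v u)"
    by (simp add: g_def double algebra_simps)
  finally have sum0: "g u v + g v u = 0" using x weight_nonzero_iff by simp
  have R: "(xs a, \<sigma>) \<notin> R" if "a \<in> {u, v}" for a \<sigma>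
    using that by (auto simp: R_def conf_def)
  have val: "g a b = (if xs a < xs b then -1 else 1) * (fsign R (xs a,Up) * fsign R (xs b,Up)) *
      \<psi> (insert (xs b,Dn) (insert (xs a,Up) R))" if ab: "a \<in> {u, v}" "b \<in> {u, v}" "a \<noteq> b" for a b
  proof -
    have "mode_less (xs a,Up) (xs b,Dn) \<longleftrightarrow> xs a < xs b" using ab by (simp add: mode_less_def)
    then have "fsign (insert (xs a,Up) R) (xs b,Dn) = (if xs a < xs b then -1 else 1) * fsign R (xs b,Up)"
      using fsign_insert[OF R[OF ab(1), of Up], of "(xs b,Dn)"] fsign_Dn_eq_Up[OF R[OF ab(2), of Up]] by simp
    then show ?thesis using R[OF ab(1)] R[OF ab(2)] ab(3) by (simp add: g_def cann_def)
  qed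
  have c1: "insert (xs v,Dn) (insert (xs u,Up) R) = conf A (insert v (D - {u}))" (is "_ = conf A ?D")
  proof -
    have A: "insert v (insert u (A - {u, v})) = A" using D by auto
    have "conf (A - {u, v}) ?D = R" unfolding R_def by (rule conf_cong) auto
    then show ?thesis
      using conf_insert[of v "insert u (A - {u, v})" ?D] conf_insert[of u "A - {u, v}" ?D] ne
      unfolding A by simp
  qed
  have c2: "insert (xs u,Dn) (insert (xs v,Up) R) = conf A D"
  proof -
    have A: "insert u (insert v (A - {u, v})) = A" using D by auto
    show ?thesis
      using conf_insert[of u "insert v (A - {u, v})" D] conf_insert[of v "A - {u, v}" D] D
      unfolding A R_def by simp
  qed
  \<comment> \<open>The two placements carry opposite fermionic signs, so the antisymmetry of
    \<open>g\<close> becomes equality of the amplitudes.\<close>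
  define s where "s = (if xs u < xs v then -1 else 1) * (fsign R (xs u,Up) * fsign R (xs v,Up))"
  have "xs u \<noteq> xs v" using ne by simp
  then have g2: "g v u = - s * \<psi> (conf A D)"
    using val[of v u] ne unfolding c2 s_def by (auto simp: not_less_iff_gr_or_eq)
  have g1: "g u v = s * \<psi> (conf A ?D)" using val[of u v] ne unfolding c1 s_def by simp
  have "s \<noteq> 0" unfolding s_def by simp
  then show ?thesis using sum0 unfolding g1 g2 by simp
qed

section \<open>Classification of the minimal-energy states\<close>

text \<open>Induction on the number of nonzero amplitudes on special-site configurations:
  subtracting a multiple of the \<open>Phi\<close> that matches one such configuration removes this
  amplitude and creates no new one.\<close>

lemma spanned_by_Phi:
  assumes b2: "B2 \<phi>" and "no_double \<psi>" "expands UNIV \<psi>" "\<psi> \<in> sector N"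
  shows "in_cspan {Phi \<phi> A m | A m. card A = N \<and> admissible \<phi> A m} \<psi>"
  using assms(2-)
proof (induction "card {S. S \<subseteq> range xs \<times> UNIV \<and> \<psi> S \<noteq> 0}" arbitrary: \<psi> rule: less_induct)
  case less
  let ?Z = "\<lambda>\<psi> :: 'x fock. {S. S \<subseteq> range xs \<times> UNIV \<and> \<psi> S \<noteq> 0}"
  let ?G = "{Phi \<phi> A m | A m. card A = N \<and> admissible \<phi> A m}"
  note nd = less.prems(1) and ex = less.prems(2) and sec = less.prems(3)
  show ?case
  proof (cases "?Z \<psi> = {}")
    case True
    then have "\<psi> = (\<lambda>_. 0)" using expands_eq_zero[OF ex] by blast
    then show ?thesis by (simp only: in_cspan_zero)
  next
    case False
    then obtain S where S: "S \<subseteq> range xs \<times> UNIV" "\<psi> S \<noteq> 0" by blast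
    obtain A D where D: "D \<subseteq> A" "S = conf A D"
      using single_occupancy_conf[OF S(1)] nd S(2) unfolding no_double_def by metis
    have cA: "card A = N" using sec S(2) card_conf[of A D] D(2) by (auto simp: sector_iff)
    \<comment> \<open>With this choice the exponent of the lowering operator on \<open>C\<close> is
      the number of down spins that \<open>D\<close> has in \<open>C\<close>.\<close>
    define m where "m C = real (card C) / 2 - real (card (D \<inter> C))" for C
    have m: "admissible \<phi> A m"
      unfolding admissible_def m_def by (auto intro!: card_mono)
    define P where "P = Phi \<phi> A m"
    have "profile A (\<lambda>C. card (D \<inter> C)) P"
      using profile_Phi[of A m] by (simp add: P_def m_def)
    then obtain K where ndP: "no_double P" and exP: "expands A P" and secP: "P \<in> sector N" and K: "K \<noteq> 0"
      and val: "\<And>D'. D' \<subseteq> A \<Longrightarrow>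
        P (conf A D') = (if \<forall>C\<in>comps \<phi> A. card (D' \<inter> C) = card (D \<inter> C) then K else 0)"
      unfolding profile_def cA by blast
    have PS: "P S = K" using val[OF D(1)] by (simp add: D(2))
    define a where "a = \<psi> S / K"
    define \<xi> where "\<xi> = (\<lambda>S. \<psi> S + (- a) * P S)"
    \<comment> \<open>Wherever \<open>P\<close> is nonzero, the configuration has the same occupied
      indices and the same down-spin counts as \<open>S\<close>; by spin exchange
      \<open>\<psi>\<close> takes the value \<open>\<psi> S\<close> there.\<close>
    have "\<psi> T \<noteq> 0" if T: "T \<subseteq> range xs \<times> UNIV" "P T \<noteq> 0" for T
    proof -
      obtain A' D' where D': "D' \<subseteq> A'" "T = conf A' D'"
        using single_occupancy_conf[OF T(1)] ndP T(2) unfolding no_double_def by metis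
      have "card A' = N" using secP T(2) card_conf[of A' D'] D'(2) by (auto simp: sector_iff)
      moreover have "A' \<subseteq> A" using expands_conf_outside[OF exP] T(2) D'(2) by blast
      ultimately have "A' = A" using cA by (intro card_subset_eq) auto
      then have T': "D' \<subseteq> A" "T = conf A D'" using D' by auto
      then have "\<forall>C\<in>comps \<phi> A. card (D' \<inter> C) = card (D \<inter> C)" using val[OF T'(1)] T(2) by presburger
      then have "\<psi> (conf A D') = \<psi> (conf A D)"
        by (rule component_counts_determine[where g = "\<lambda>D. \<psi> (conf A D)", rotated 3])
          (use spin_exchange[OF b2 nd ex] D T' in auto)
      then show ?thesis using S(2) D(2) T'(2) by simp
    qed
    then have sub: "?Z \<xi> \<subseteq> ?Z \<psi>" by (auto simp: \<xi>_def)
    have "\<xi> S = 0" using K by (simp add: \<xi>_def a_def PS)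
    then have "?Z \<xi> \<subset> ?Z \<psi>" using sub S by blast
    then have "card (?Z \<xi>) < card (?Z \<psi>)" by (intro psubset_card_mono) auto
    moreover have "no_double \<xi>" using nd ndP by (simp add: no_double_def \<xi>_def)
    moreover have "expands UNIV \<xi>"
      unfolding \<xi>_def by (intro expands_linear ex expands_mono[OF exP]) auto
    moreover have "\<xi> \<in> sector N" using sec secP by (force simp: sector_iff \<xi>_def)
    ultimately have "in_cspan ?G \<xi>" by (rule less.hyps)
    then have "in_cspan ?G (\<lambda>S. \<xi> S + a * P S)"
      using cA m by (intro in_cspan_add) (auto simp: P_def)
    then show ?thesis by (simp add: \<xi>_def)
  qed
qed

text \<open>Without double occupancy the special sites hold at most one electron per index, so no
  special-site configuration has \<open>N\<close> electrons and a nonzero amplitude.\<close>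

lemma expands_vanish:
  assumes "no_double \<psi>" "expands UNIV \<psi>" "\<psi> \<in> sector N" "card (UNIV :: 'v set) < N"
  shows "\<psi> = (\<lambda>_. 0)"
proof
  fix S show "\<psi> S = 0"
  proof (rule expands_eq_zero[OF assms(2)], rule ccontr)
    fix S assume S: "S \<subseteq> range xs \<times> UNIV" "\<psi> S \<noteq> 0"
    obtain A D where "S = conf A D"
      using single_occupancy_conf[OF S(1)] assms(1) S(2) unfolding no_double_def by metis
    then have "card A = N" using assms(3) S(2) card_conf[of A D] by (auto simp: sector_iff)
    then show False using card_mono[of UNIV A] assms(4) by simp
  qed
qed

lemma H0_imp_expands:
  assumes "B0 t \<phi>" and "\<And>\<sigma> S. (\<lambda>x. cann (x,\<sigma>) \<psi> S) \<in> H0 t"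
  shows "expands UNIV \<psi>"
  unfolding expands_def
proof (intro allI)
  fix \<sigma> S x
  obtain c where "\<And>x. cann (x,\<sigma>) \<psi> S = (\<Sum>u\<in>UNIV. c u * \<phi> u x)"
    using assms(1) assms(2)[of \<sigma> S] unfolding B0_def by meson
  then show "cann (x,\<sigma>) \<psi> S = (\<Sum>u\<in>UNIV. weight u x * cann (xs u,\<sigma>) \<psi> S)"
    by (rule span_expand)
qed

lemma expands_imp_H0:
  assumes b0: "B0 t \<phi>" and ex: "expands UNIV \<psi>"
  shows "(\<lambda>x. cann (x,\<sigma>) \<psi> S) \<in> H0 t"
proof -
  define c where "c u = cann (xs u,\<sigma>) \<psi> S / \<phi> u (xs u)" for u
  have e: "cann (x,\<sigma>) \<psi> S = (\<Sum>u\<in>UNIV. c u * \<phi> u x)" for x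
    using expandsD[OF ex, of x \<sigma> S] by (simp add: c_def weight_def mult.commute)
  have phi: "(\<Sum>y\<in>UNIV. of_real (t x y) * \<phi> u y) = of_real (eps0 t) * \<phi> u x" for u x
    using b0 by (simp add: B0_def H0_def)
  have "(\<Sum>y\<in>UNIV. of_real (t x y) * (\<Sum>u\<in>UNIV. c u * \<phi> u y)) =
      of_real (eps0 t) * (\<Sum>u\<in>UNIV. c u * \<phi> u x)" for x
  proof -
    have "(\<Sum>y\<in>UNIV. of_real (t x y) * (\<Sum>u\<in>UNIV. c u * \<phi> u y)) =
        (\<Sum>y\<in>UNIV. \<Sum>u\<in>UNIV. c u * (of_real (t x y) * \<phi> u y))"
      by (simp only: sum_distrib_left mult.left_commute)
    also have "\<dots> = (\<Sum>u\<in>UNIV. \<Sum>y\<in>UNIV. c u * (of_real (t x y) * \<phi> u y))" by (rule sum.swap)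
    also have "\<dots> = (\<Sum>u\<in>UNIV. c u * (of_real (eps0 t) * \<phi> u x))"
      unfolding sum_distrib_left[symmetric] phi ..
    also have "\<dots> = of_real (eps0 t) * (\<Sum>u\<in>UNIV. c u * \<phi> u x)"
      by (simp only: sum_distrib_left mult.left_commute)
    finally show ?thesis .
  qed
  then show ?thesis by (simp only: H0_def mem_Collect_eq e) blast
qed

end

section \<open>Ground state energies below and above the degeneracy\<close>

theorem theorem3p2:
  fixes t :: "'x::{finite,linorder} \<Rightarrow> 'x \<Rightarrow> real"
    and U :: "'x \<Rightarrow> real"
    and \<phi> :: "'v::{finite,linorder} \<Rightarrow> 'x \<Rightarrow> complex"
    and N :: nat
  assumes t_sym: "\<forall>x y. t x y = t y x"
    and U_pos: "\<forall>x. U x > 0"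
    and b0: "B0 t \<phi>" and b1: "B1 \<phi>" and b2: "B2 \<phi>"
  shows "(N \<le> card (UNIV::'v set) \<longrightarrow>
           ground_energy (hubbard t U) N = real N * eps0 t
         \<and> (\<forall>\<psi>\<in>ground_states (hubbard t U) N.
              in_cspan {Phi \<phi> A m | A m. card A = N \<and> admissible \<phi> A m} \<psi>))
       \<and> (card (UNIV::'v set) < N \<and> N \<le> 2 * card (UNIV::'x set) \<longrightarrow>
           ground_energy (hubbard t U) N > real N * eps0 t)"
proof -
  obtain xs where xs: "\<And>u. \<phi> u (xs u) \<noteq> 0 \<and> (\<forall>v. v \<noteq> u \<longrightarrow> \<phi> v (xs u) = 0)"
    using b1 unfolding B1_def by metis
  interpret local_basis \<phi> xs by unfold_locales (use xs in auto)
  let ?E = "sector_eigvals (hubbard t U) N"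
  note fin = finite_sector_eigvals[OF t_sym, of U N]
  have ground: "no_double \<psi>" "expands UNIV \<psi>"
    if sec: "\<psi> \<in> sector N" and eq: "hubbard t U \<psi> = (\<lambda>S. of_real (real N * eps0 t) * \<psi> S)" for \<psi>
  proof -
    have e: "fock_inner \<psi> (hubbard t U \<psi>) = real N * eps0 t * fock_inner \<psi> \<psi>"
      unfolding eq by (rule fock_inner_scale_right)
    show "no_double \<psi>" by (rule minimal_energy_imp[OF t_sym U_pos sec e])
    show "expands UNIV \<psi>" by (rule H0_imp_expands[OF b0 minimal_energy_imp(2)[OF t_sym U_pos sec e]])
  qed
  show ?thesis
  proof (intro conjI impI)
    assume N: "N \<le> card (UNIV :: 'v set)"
    then obtain A :: "'v set" where A: "card A = N"
      using obtain_subset_with_card_n[of N "UNIV :: 'v set"] by auto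
    \<comment> \<open>The fully polarized state on any \<open>N\<close> indices attains the lower
      bound.\<close>
    let ?\<psi> = "up_state \<phi> A"
    obtain K where nd: "no_double ?\<psi>" and ex: "expands A ?\<psi>" and sec: "?\<psi> \<in> sector N"
      and K: "K \<noteq> 0" and val: "\<forall>D\<subseteq>A. ?\<psi> (conf A D) = (if \<forall>C\<in>comps \<phi> A. card (D \<inter> C) = 0 then K else 0)"
      using profile_up_state[of A] unfolding profile_def A by blast
    have "?\<psi> (conf A {}) = K" using val by simp
    then have "?\<psi> \<noteq> (\<lambda>_. 0)" using K by auto
    moreover have "hubbard t U ?\<psi> = (\<lambda>S. of_real (real N * eps0 t) * ?\<psi> S)"
      by (intro minimal_energy_eigenstate sec nd expands_imp_H0[OF b0] expands_mono[OF ex]) simp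
    ultimately have "real N * eps0 t \<in> ?E" unfolding sector_eigvals_def using sec by blast
    then show E: "ground_energy (hubbard t U) N = real N * eps0 t"
      unfolding ground_energy_def
      by (intro Min_eqI fin sector_eigvals_ge[OF t_sym U_pos])
    show "\<forall>\<psi>\<in>ground_states (hubbard t U) N.
        in_cspan {Phi \<phi> A m | A m. card A = N \<and> admissible \<phi> A m} \<psi>"
    proof
      fix \<psi> assume "\<psi> \<in> ground_states (hubbard t U) N"
      then have "\<psi> \<in> sector N" "hubbard t U \<psi> = (\<lambda>S. of_real (real N * eps0 t) * \<psi> S)"
        by (simp_all only: ground_states_def E mem_Collect_eq)
      then show "in_cspan {Phi \<phi> A m | A m. card A = N \<and> admissible \<phi> A m} \<psi>"
        by (intro spanned_by_Phi b2 ground)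
    qed
  next
    assume N: "card (UNIV :: 'v set) < N \<and> N \<le> 2 * card (UNIV :: 'x set)"
    then have "?E \<noteq> {}" using sector_eigvals_nonempty[OF t_sym] by blast
    then have in_E: "ground_energy (hubbard t U) N \<in> ?E"
      unfolding ground_energy_def by (rule Min_in[OF fin])
    \<comment> \<open>The lower bound cannot be attained, since a minimal-energy state with more
      electrons than indices vanishes; the least eigenvalue, which exists, must therefore exceed
      it.\<close>
    have "real N * eps0 t \<notin> ?E"
    proof
      assume "real N * eps0 t \<in> ?E"
      then obtain \<psi> where "\<psi> \<in> sector N" "\<psi> \<noteq> (\<lambda>_. 0)"
        "hubbard t U \<psi> = (\<lambda>S. of_real (real N * eps0 t) * \<psi> S)"
        unfolding sector_eigvals_def by blast
      then show False using expands_vanish[of \<psi> N] ground[of \<psi>] N by blast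
    qed
    then show "ground_energy (hubbard t U) N > real N * eps0 t"
      using in_E sector_eigvals_ge[OF t_sym U_pos in_E] by (metis order_le_imp_less_or_eq)
  qed
qed

end
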